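(* Let $D_1\subseteq D_2\subsetneq\mathbb{C}$ be two simply connected domains such that $D_1$ is internally tangent to $D_2$ at $\zeta\in\partial_CD_2$. Fix any geodesic $\gamma\colon[0,+\infty)\to D_2$ of $D_2$ landing at $\zeta$ and a number $K>1$. Then, for any $R>0$ there exists some $t_1\ge 0$ such that (a) $S_{D_2}(\gamma|_{[t_1,+\infty)},R)\subseteq D_1$; (b) $\lambda_{D_2}(z)\le \lambda_{D_1}(z)\le K \lambda_{D_2}(z)$, for all $z\in S_{D_2}(\gamma|_{[t_1,+\infty)},R)$; and (c) $d_{D_2}(z,w)\le d_{D_1}(z,w)\le K d_{D_2}(z,w)$, for all $z,w\in S_{D_2}(\gamma|_{[t_1,+\infty)},R)$.
   Context: For a simply connected domain $D\subsetneq\mathbb{C}$, $\partial_CD$ is the set of prime ends of $D$; any Riemann map $g\colon\mathbb{D}\to D$ of the unit disc extends to a homeomorphism $g\colon\mathbb{D}\cup\partial\mathbb{D}\to D\cup\partial_CD$ (Carathéodory topology). The hyperbolic metric $\lambda_D$ is given by $\lambda_D(g(z))|g'(z)|=\frac{1}{1-|z|^2}$, and $d_D$ is the induced distance. A curve $\gamma\colon I\to D$, $I\subseteq\mathbb{R}$ an interval, is a geodesic of $D$ if the hyperbolic length of $\gamma$ between $t_1$ and $t_2$ equals $d_D(\gamma(t_1),\gamma(t_2))$ for all $t_1\le t_2$ in $I$. A curve $\gamma\colon[0,+\infty)\to D$ lands at $\zeta\in\partial_CD$ if $\lim_{t\to+\infty}g^{-1}(\gamma(t))=\sigma$, where $\sigma\in\partial\mathbb{D}$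 is the point with $g(\sigma)=\zeta$. For a geodesic $\gamma\colon[0,+\infty)\to D$, $t_0\ge0$ and $R>0$, $S_D(\gamma|_{[t_0,+\infty)},R)=\{z\in D\colon \inf_{t\ge t_0}d_D(z,\gamma(t))<R\}$. For simply connected $D_1\subseteq D_2\subsetneq\mathbb{C}$ and $\zeta\in\partial_CD_2$, $D_1$ is internally tangent to $D_2$ at $\zeta$ if there is a geodesic $\gamma\colon[0,+\infty)\to D_2$ of $D_2$ landing at $\zeta$ such that for any $R>0$ there exists $t_0\ge0$ with $S_{D_2}(\gamma|_{[t_0,+\infty)},R)\subseteq D_1$ (this is independent of the choice of $\gamma$). *)

theory Defs
  imports "HOL-Complex_Analysis.Complex_Analysis"
begin

section \<open>Simply connected domains and Riemann maps\<close>

definition sc_domain :: "complex set \<Rightarrow> bool" where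
  "sc_domain D \<longleftrightarrow> open D \<and> D \<noteq> {} \<and> simply_connected D"

definition riemann_map :: "complex set \<Rightarrow> (complex \<Rightarrow> complex) \<Rightarrow> bool" where
  "riemann_map D g \<longleftrightarrow>
     g holomorphic_on ball 0 1 \<and> inj_on g (ball 0 1) \<and> g ` ball 0 1 = D"

section \<open>Prime ends and the Caratheodory topology\<close>

text \<open>
  The domain may be unbounded, so boundary points of crosscuts, closures and diameters are taken
  in the Riemann sphere. It is realised as the unit sphere of \<open>complex \<times> real\<close>, whose
  Euclidean metric is the chordal metric; the point at infinity is \<open>(0, 1)\<close>.
\<close>

definition stereo :: "complex \<Rightarrow> complex \<times> real" where
  "stereo z = ((2 / (1 + (cmod z)\<^sup>2)) *\<^sub>R z, ((cmod z)\<^sup>2 - 1) / ((cmod z)\<^sup>2 + 1))"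

text \<open>
  A crosscut is an open Jordan arc in \<open>D\<close> with both endpoints on the boundary of \<open>D\<close> in the
  sphere. The two endpoints may coincide, hence \<open>simple_path\<close> and not \<open>arc\<close>.
\<close>

definition crosscut :: "complex set \<Rightarrow> complex set \<Rightarrow> bool" where
  "crosscut D C \<longleftrightarrow> C \<subseteq> D \<and>
     (\<exists>p. simple_path p \<and> p ` {0<..<1} = stereo ` C \<and>
          pathstart p \<in> closure (stereo ` D) - stereo ` D \<and>
          pathfinish p \<in> closure (stereo ` D) - stereo ` D)"

definition separates_in :: "complex set \<Rightarrow> complex set \<Rightarrow> complex set \<Rightarrow> complex set \<Rightarrow> bool" where
  "separates_in D C A B \<longleftrightarrow> A \<subseteq> D - C \<and> B \<subseteq> D - C \<and>
     (\<forall>a\<in>A. \<forall>b\<in>B. \<not> connected_component (D - C) a b)"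

definition null_chain :: "complex set \<Rightarrow> (nat \<Rightarrow> complex set) \<Rightarrow> bool" where
  "null_chain D C \<longleftrightarrow>
     (\<forall>n. crosscut D (C n)) \<and>
     (\<forall>n. closure (stereo ` C n) \<inter> closure (stereo ` C (Suc n)) = {}) \<and>
     (\<forall>n\<ge>1. separates_in D (C n) (C 0) (C (Suc n))) \<and>
     (\<lambda>n. diameter (stereo ` C n)) \<longlonglongrightarrow> 0"

text \<open>
  For \<open>n \<ge> 1\<close>, the component of \<open>D - C n\<close> that does not contain \<open>C 0\<close>. (A crosscut splits \<open>D\<close>
  into exactly two components. For \<open>n = 0\<close> the set below is empty and is never used.)
\<close>

definition inner_part :: "complex set \<Rightarrow> (nat \<Rightarrow> complex set) \<Rightarrow> nat \<Rightarrow> complex set" where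
  "inner_part D C n = {z. separates_in D (C n) (C 0) {z}}"

definition null_chain_rel ::
  "complex set \<Rightarrow> ((nat \<Rightarrow> complex set) \<times> (nat \<Rightarrow> complex set)) set" where
  "null_chain_rel D = {(C, C'). null_chain D C \<and> null_chain D C' \<and>
     (\<forall>n\<ge>1. \<exists>m\<ge>1. inner_part D C' m \<subseteq> inner_part D C n) \<and>
     (\<forall>n\<ge>1. \<exists>m\<ge>1. inner_part D C m \<subseteq> inner_part D C' n)}"

type_synonym prime_end = "(nat \<Rightarrow> complex set) set"

definition prime_ends :: "complex set \<Rightarrow> prime_end set" where
  "prime_ends D = {C. null_chain D C} // null_chain_rel D"

text \<open>
  In the disjoint union of \<open>D\<close> and its prime ends, an open \<open>U \<subseteq> D\<close> is enlarged by the prime ends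
  whose null chains eventually bound inner parts contained in \<open>U\<close>. These sets are closed under
  finite intersections, so they form a base of the Caratheodory topology.
\<close>

definition prime_end_hull :: "complex set \<Rightarrow> complex set \<Rightarrow> (complex + prime_end) set" where
  "prime_end_hull D U =
     Inl ` U \<union> Inr ` {\<zeta> \<in> prime_ends D. \<forall>C\<in>\<zeta>. \<exists>n\<ge>1. inner_part D C n \<subseteq> U}"

definition caratheodory_topology :: "complex set \<Rightarrow> (complex + prime_end) topology" where
  "caratheodory_topology D =
     topology_generated_by {prime_end_hull D U | U. open U \<and> U \<subseteq> D}"

definition boundary_extension ::
  "complex set \<Rightarrow> (complex \<Rightarrow> complex) \<Rightarrow> (complex \<Rightarrow> complex + prime_end) \<Rightarrow> bool" where
  "boundary_extension D g G \<longleftrightarrow>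
     homeomorphic_map (top_of_set (cball 0 1)) (caratheodory_topology D) G \<and>
     (\<forall>z\<in>ball 0 1. G z = Inl (g z))"

section \<open>Hyperbolic geometry\<close>

text \<open>
  The value does not depend on the Riemann map \<open>g\<close>, by conformal invariance of the density of the
  disc. The density is meaningful only at points of \<open>D\<close>.
\<close>

definition hyp_density :: "complex set \<Rightarrow> complex \<Rightarrow> real" where
  "hyp_density D w = (THE l. \<exists>g z. riemann_map D g \<and> z \<in> ball 0 1 \<and> g z = w \<and>
     l * cmod (deriv g z) = 1 / (1 - (cmod z)\<^sup>2))"

definition hyp_speed :: "complex set \<Rightarrow> (real \<Rightarrow> complex) \<Rightarrow> real \<Rightarrow> real" where
  "hyp_speed D \<gamma> t = hyp_density D (\<gamma> t) * cmod (vector_derivative \<gamma> (at t))"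

text \<open>
  The predicate \<open>piecewise_C1_differentiable_on\<close> does not bound the derivative near the finitely
  many exceptional points, so a curve satisfying it can have infinite length, for which
  \<open>integral\<close> would return the default value 0. Hence integrability of the speed is required.
\<close>

definition hyp_rectifiable :: "complex set \<Rightarrow> (real \<Rightarrow> complex) \<Rightarrow> real \<Rightarrow> real \<Rightarrow> bool" where
  "hyp_rectifiable D \<gamma> a b \<longleftrightarrow> \<gamma> ` {a..b} \<subseteq> D \<and>
     \<gamma> piecewise_C1_differentiable_on {a..b} \<and> hyp_speed D \<gamma> integrable_on {a..b}"

definition hyp_length :: "complex set \<Rightarrow> (real \<Rightarrow> complex) \<Rightarrow> real \<Rightarrow> real \<Rightarrow> real" where
  "hyp_length D \<gamma> a b = integral {a..b} (hyp_speed D \<gamma>)"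

definition hyp_dist :: "complex set \<Rightarrow> complex \<Rightarrow> complex \<Rightarrow> real" where
  "hyp_dist D z w = Inf {hyp_length D p 0 1 | p.
     hyp_rectifiable D p 0 1 \<and> p 0 = z \<and> p 1 = w}"

definition hyp_geodesic_on :: "complex set \<Rightarrow> real set \<Rightarrow> (real \<Rightarrow> complex) \<Rightarrow> bool" where
  "hyp_geodesic_on D I \<gamma> \<longleftrightarrow> is_interval I \<and> \<gamma> ` I \<subseteq> D \<and>
     (\<forall>t1\<in>I. \<forall>t2\<in>I. t1 \<le> t2 \<longrightarrow> hyp_rectifiable D \<gamma> t1 t2 \<and>
        hyp_length D \<gamma> t1 t2 = hyp_dist D (\<gamma> t1) (\<gamma> t2))"

text \<open>
  Every Riemann map has a unique boundary extension (Caratheodory), and any two of them differ by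
  an automorphism of the disc, so it does not matter which Riemann map is used.
\<close>

definition lands_at :: "complex set \<Rightarrow> (real \<Rightarrow> complex) \<Rightarrow> prime_end \<Rightarrow> bool" where
  "lands_at D \<gamma> \<zeta> \<longleftrightarrow> \<zeta> \<in> prime_ends D \<and>
     (\<exists>g G \<sigma>. riemann_map D g \<and> boundary_extension D g G \<and> \<sigma> \<in> sphere 0 1 \<and> G \<sigma> = Inr \<zeta> \<and>
        ((\<lambda>t. the_inv_into (ball 0 1) g (\<gamma> t)) \<longlongrightarrow> \<sigma>) at_top)"

definition hyp_sector :: "complex set \<Rightarrow> (real \<Rightarrow> complex) \<Rightarrow> real \<Rightarrow> real \<Rightarrow> complex set" where
  "hyp_sector D \<gamma> t0 R = {z \<in> D. (INF t\<in>{t0..}. hyp_dist D z (\<gamma> t)) < R}"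

definition internally_tangent :: "complex set \<Rightarrow> complex set \<Rightarrow> prime_end \<Rightarrow> bool" where
  "internally_tangent D1 D2 \<zeta> \<longleftrightarrow>
     (\<exists>\<gamma>. hyp_geodesic_on D2 {0..} \<gamma> \<and> lands_at D2 \<gamma> \<zeta> \<and>
        (\<forall>R>0. \<exists>t0\<ge>0. hyp_sector D2 \<gamma> t0 R \<subseteq> D1))"

end

theory Submission
  imports Defs
begin

text \<open>
  Choose a Riemann map of \<open>D2\<close> and compose it with a Cayley transform, so that \<open>D2\<close> becomes the right
  half-plane with density \<open>1 / (2 Re w)\<close> and the prime end \<open>\<zeta>\<close> becomes infinity. A geodesic ray that
  lands at \<open>\<zeta>\<close> is then a horizontal half-line (\<open>geodesic_ray_horizontal\<close>, by a Busemann function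
  argument). This holds for the given \<open>\<gamma>\<close> and for the geodesic that witnesses the tangency, since by
  \<open>lands_at_common_riemann_map\<close> both tend to infinity in one and the same chart.

  The sectors around such a ray are, up to constants, the wedges \<open>\<bar>Im w\<bar> < M Re w\<close>, \<open>Re w > a\<close>
  (\<open>sector_subset_wedge\<close>, \<open>wedge_subset_of_sectors\<close>). Hence internal tangency says that \<open>D1\<close> contains a
  wedge of every slope \<open>M\<close>, provided that \<open>a\<close> is large, and it is enough to prove the estimates on
  wedges. Since discs of a fixed hyperbolic radius distort slopes only by a bounded amount
  (\<open>pseudo_disc_wedge\<close>), all points of a wedge that are far enough out are centres of large hyperbolic
  discs inside \<open>D1\<close>.

  The density estimate is then the Schwarz lemma (\<open>schwarz_inclusion\<close>): if the pseudohyperbolic disc of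
  radius \<open>r\<close> around a point lies in \<open>D1\<close>, the density of \<open>D1\<close> at the point is at most \<open>1 / r\<close> times
  that of \<open>D2\<close>; take \<open>r = 1 / K\<close>. Integrated along curves, the bounds for the densities give the bounds for
  the distances, if the curves that compete for the distance in \<open>D2\<close> can be taken inside a wedge on
  which the density estimate holds. For this, \<open>retract_path_to_wedge\<close> moves an arbitrary curve of
  \<open>D2\<close> into a slightly larger wedge, keeps its end points, and does not increase its speed.
\<close>

section \<open>Half-plane charts\<close>

abbreviation rhp :: "complex set" where "rhp \<equiv> {w. 0 < Re w}"

text \<open>
  The conformal map of the unit disc onto the right half-plane that takes 0 to \<open>w0\<close>; its inverse is
  \<open>w \<mapsto> (w - w0) / (w + cnj w0)\<close>. The choice \<open>w0 = 1\<close> is the usual Cayley transform.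
\<close>

definition cayley :: "complex \<Rightarrow> complex \<Rightarrow> complex" where
  "cayley w0 z = (w0 + cnj w0 * z) / (1 - z)"

lemma Re_cayley:
  assumes "z \<noteq> 1"
  shows "Re (cayley w0 z) = Re w0 * (1 - (cmod z)\<^sup>2) / (cmod (1 - z))\<^sup>2"
  using assms
  unfolding cayley_def Re_divide cmod_power2 by (simp add: algebra_simps power2_eq_square)

lemma cayley_rhp:
  assumes "w0 \<in> rhp" "z \<in> ball 0 1"
  shows "cayley w0 z \<in> rhp"
proof -
  have "z \<noteq> 1" using assms by auto
  moreover have "(cmod z)\<^sup>2 < 1" using assms by (simp add: power_less_one_iff abs_square_less_1)
  ultimately show ?thesis using assms(1) by (simp add: Re_cayley)
qed

lemma holomorphic_cayley: "cayley w0 holomorphic_on ball 0 1"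
  unfolding cayley_def by (intro holomorphic_intros) auto

lemma rhp_add_cnj_neq_0: "w0 \<in> rhp \<Longrightarrow> w \<in> rhp \<Longrightarrow> w + cnj w0 \<noteq> 0"
  by (auto simp: complex_eq_iff)

text \<open>
  The pseudohyperbolic distance of the half-plane: the modulus of \<open>w\<close> as seen in the disc centred at
  \<open>w0\<close>. The hyperbolic distance is its inverse hyperbolic tangent.
\<close>

definition pseudo_dist :: "complex \<Rightarrow> complex \<Rightarrow> real" where
  "pseudo_dist w0 w = cmod ((w - w0) / (w + cnj w0))"

lemma one_minus_pseudo_dist:
  assumes "w0 \<in> rhp" "w \<in> rhp"
  shows "1 - (pseudo_dist w0 w)\<^sup>2 = 4 * Re w0 * Re w / (cmod (w + cnj w0))\<^sup>2"
proof -
  have "(cmod (w + cnj w0))\<^sup>2 - (cmod (w - w0))\<^sup>2 = 4 * Re w0 * Re w"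
    unfolding cmod_power2 by (simp add: power2_eq_square algebra_simps)
  moreover have "1 - (pseudo_dist w0 w)\<^sup>2
      = ((cmod (w + cnj w0))\<^sup>2 - (cmod (w - w0))\<^sup>2) / (cmod (w + cnj w0))\<^sup>2"
    using rhp_add_cnj_neq_0[OF assms]
    unfolding pseudo_dist_def norm_divide power_divide by (simp add: diff_divide_distrib)
  ultimately show ?thesis by simp
qed

lemma pseudo_dist_bounds:
  assumes "w0 \<in> rhp" "w \<in> rhp"
  shows "0 \<le> pseudo_dist w0 w" "pseudo_dist w0 w < 1"
proof -
  show "0 \<le> pseudo_dist w0 w" by (simp add: pseudo_dist_def)
  have "0 < 1 - (pseudo_dist w0 w)\<^sup>2"
    unfolding one_minus_pseudo_dist[OF assms]
    using assms rhp_add_cnj_neq_0[OF assms] by simp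
  then have "(pseudo_dist w0 w)\<^sup>2 < 1" by simp
  then show "pseudo_dist w0 w < 1"
    by (simp add: abs_square_less_1)
qed

lemma cayley_inverse:
  assumes "w0 \<in> rhp" "z \<in> ball 0 1"
  shows "(cayley w0 z - w0) / (cayley w0 z + cnj w0) = z"
proof -
  have "z \<noteq> 1" "w0 + cnj w0 \<noteq> 0" using assms rhp_add_cnj_neq_0 by auto
  have a: "cayley w0 z - w0 = (w0 + cnj w0) * z / (1 - z)"
    using \<open>z \<noteq> 1\<close> by (simp add: cayley_def field_simps)
  have b: "cayley w0 z + cnj w0 = (w0 + cnj w0) / (1 - z)"
    using \<open>z \<noteq> 1\<close> by (simp add: cayley_def field_simps)
  show ?thesis unfolding a b using \<open>z \<noteq> 1\<close> \<open>w0 + cnj w0 \<noteq> 0\<close> by simp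
qed

lemma cayley_of_inverse:
  assumes "w0 \<in> rhp" "w \<in> rhp"
  shows "cayley w0 ((w - w0) / (w + cnj w0)) = w"
proof -
  have ne: "w + cnj w0 \<noteq> 0" "w0 + cnj w0 \<noteq> 0" using assms rhp_add_cnj_neq_0 by auto
  have a: "w0 + cnj w0 * ((w - w0) / (w + cnj w0)) = w * (w0 + cnj w0) / (w + cnj w0)"
    using ne by (simp add: field_simps)
  have b: "1 - (w - w0) / (w + cnj w0) = (w0 + cnj w0) / (w + cnj w0)"
    using ne by (simp add: field_simps)
  show ?thesis unfolding cayley_def a b using ne by simp
qed

lemma cayley_inverse_ball:
  assumes "w0 \<in> rhp" "w \<in> rhp"
  shows "(w - w0) / (w + cnj w0) \<in> ball 0 1"
  using pseudo_dist_bounds[OF assms] by (simp add: pseudo_dist_def)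

lemma deriv_cayley_0: "(cayley w0 has_field_derivative (2 * Re w0)) (at 0)"
proof -
  have "cnj w0 + w0 = of_real (2 * Re w0)" by (simp add: complex_eq_iff)
  then show ?thesis unfolding cayley_def
    by (auto intro!: derivative_eq_intros)
qed

text \<open>
  Charts use the half-plane instead of the disc because a prime end can then be placed at infinity,
  where geodesic rays become horizontal lines and their neighbourhoods become wedges. The inverse
  \<open>k\<close> is a parameter of its own so that an explicit formula for it, from which limits can be read
  off, can be supplied.
\<close>

locale half_plane_chart =
  fixes D :: "complex set" and h k :: "complex \<Rightarrow> complex"
  assumes open_D: "open D"
    and hol_h: "h holomorphic_on rhp" and hol_k: "k holomorphic_on D"
    and h_D: "\<And>w. w \<in> rhp \<Longrightarrow> h w \<in> D" and k_rhp: "\<And>z. z \<in> D \<Longrightarrow> k z \<in> rhp"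
    and k_h: "\<And>w. w \<in> rhp \<Longrightarrow> k (h w) = w" and h_k: "\<And>z. z \<in> D \<Longrightarrow> h (k z) = z"

lemma open_rhp: "open rhp"
  by (rule open_halfspace_Re_gt)

context half_plane_chart
begin

lemma inj_h: "inj_on h rhp"
  by (metis inj_onI k_h)

lemma deriv_h_nonzero: "w \<in> rhp \<Longrightarrow> deriv h w \<noteq> 0"
  using holomorphic_injective_imp_regular[OF hol_h open_rhp inj_h] by blast

lemma riemann_map_cayley:
  assumes "w0 \<in> rhp"
  shows "riemann_map D (h \<circ> cayley w0)"
  unfolding riemann_map_def
proof (intro conjI)
  show "h \<circ> cayley w0 holomorphic_on ball 0 1"
    by (rule holomorphic_on_compose_gen[OF holomorphic_cayley hol_h]) (use cayley_rhp[OF assms] in auto)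
  show "inj_on (h \<circ> cayley w0) (ball 0 1)"
  proof (rule inj_onI)
    fix x y assume xy: "x \<in> ball 0 1" "y \<in> ball 0 1" "(h \<circ> cayley w0) x = (h \<circ> cayley w0) y"
    then have "cayley w0 x = cayley w0 y"
      using k_h[OF cayley_rhp[OF assms]] by (metis comp_apply)
    then show "x = y" using cayley_inverse[OF assms] xy by metis
  qed
  show "(h \<circ> cayley w0) ` ball 0 1 = D"
  proof
    show "(h \<circ> cayley w0) ` ball 0 1 \<subseteq> D"
      using h_D[OF cayley_rhp[OF assms]] by auto
    show "D \<subseteq> (h \<circ> cayley w0) ` ball 0 1"
    proof
      fix z assume "z \<in> D"
      then have "z = (h \<circ> cayley w0) ((k z - w0) / (k z + cnj w0))"
        using cayley_of_inverse[OF assms k_rhp] h_k by simp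
      then show "z \<in> (h \<circ> cayley w0) ` ball 0 1"
        using cayley_inverse_ball[OF assms k_rhp[OF \<open>z \<in> D\<close>]] by (rule image_eqI)
    qed
  qed
qed

lemma cayley_at_0: "(h \<circ> cayley w0) 0 = h w0"
  by (simp add: cayley_def)

lemma deriv_h_cayley:
  assumes "w0 \<in> rhp"
  shows "deriv (h \<circ> cayley w0) 0 = deriv h w0 * (2 * Re w0)"
proof -
  have "(h has_field_derivative deriv h w0) (at (cayley w0 0))"
    using holomorphic_derivI[OF hol_h open_rhp assms] by (simp add: cayley_def)
  from DERIV_chain[OF this deriv_cayley_0] show ?thesis by (rule DERIV_imp_deriv)
qed

end

lemma riemann_map_inverse:
  assumes "riemann_map D g"
  shows "the_inv_into (ball 0 1) g holomorphic_on D"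
    and "\<And>z. z \<in> ball 0 1 \<Longrightarrow> the_inv_into (ball 0 1) g (g z) = z"
    and "\<And>w. w \<in> D \<Longrightarrow> the_inv_into (ball 0 1) g w \<in> ball 0 1"
    and "\<And>w. w \<in> D \<Longrightarrow> g (the_inv_into (ball 0 1) g w) = w"
    and "open D"
proof -
  have g: "g holomorphic_on ball 0 1" "inj_on g (ball 0 1)" "g ` ball 0 1 = D"
    using assms by (auto simp: riemann_map_def)
  show inv: "\<And>z. z \<in> ball 0 1 \<Longrightarrow> the_inv_into (ball 0 1) g (g z) = z"
    using g(2) by (rule the_inv_into_f_f)
  obtain f where f: "f holomorphic_on g ` ball 0 1" "\<And>z. z \<in> ball 0 1 \<Longrightarrow> f (g z) = z"
    using holomorphic_has_inverse[OF g(1) open_ball g(2)] by metis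
  show "the_inv_into (ball 0 1) g holomorphic_on D"
    using f(1) unfolding g(3) by (rule holomorphic_transform) (use g(3) f(2) inv in auto)
  show "\<And>w. w \<in> D \<Longrightarrow> the_inv_into (ball 0 1) g w \<in> ball 0 1"
    using inv g(3) by fastforce
  show "\<And>w. w \<in> D \<Longrightarrow> g (the_inv_into (ball 0 1) g w) = w"
    using g by (simp add: f_the_inv_into_f)
  show "open D" using open_mapping_thm3[OF g(1) open_ball g(2)] g(3) by simp
qed

text \<open>
  The number \<open>\<sigma>\<close> is the point of the circle that the chart sends to infinity.
\<close>

lemma half_plane_chart_of_riemann_map:
  assumes g: "riemann_map D g" and \<sigma>: "cmod \<sigma> = 1"
  shows "half_plane_chart D (\<lambda>w. g (\<sigma> * ((w - 1) / (w + 1))))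
    (\<lambda>z. cayley 1 (the_inv_into (ball 0 1) g z / \<sigma>))"
proof -
  let ?f = "the_inv_into (ball 0 1) g"
  have 1: "(1::complex) \<in> rhp" by simp
  have [simp]: "\<sigma> \<noteq> 0" using \<sigma> by auto
  have ball: "\<sigma> * ((w - 1) / (w + 1)) \<in> ball 0 1" if "w \<in> rhp" for w
    using cayley_inverse_ball[OF 1 that] \<sigma> by (simp del: times_divide_eq_right add: norm_mult)
  have ball': "z / \<sigma> \<in> ball 0 1" if "z \<in> ball 0 1" for z
    using that \<sigma> by (simp add: norm_divide)
  note inv = riemann_map_inverse[OF g]
  have g': "g holomorphic_on ball 0 1" "g ` ball 0 1 = D"
    using g by (auto simp: riemann_map_def)
  show ?thesis
  proof
    show "open D" by (rule inv)
    have "g \<circ> (\<lambda>w. \<sigma> * ((w - 1) / (w + 1))) holomorphic_on rhp"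
    proof (rule holomorphic_on_compose_gen[OF _ g'(1)])
      show "(\<lambda>w. \<sigma> * ((w - 1) / (w + 1))) holomorphic_on rhp"
        using rhp_add_cnj_neq_0[OF 1] by (intro holomorphic_intros) auto
    qed (use ball in auto)
    then show "(\<lambda>w. g (\<sigma> * ((w - 1) / (w + 1)))) holomorphic_on rhp" by (simp add: o_def)
    have "cayley 1 \<circ> (\<lambda>z. ?f z / \<sigma>) holomorphic_on D"
      by (rule holomorphic_on_compose_gen[OF _ holomorphic_cayley])
         (use inv ball' in \<open>auto intro!: holomorphic_intros\<close>)
    then show "(\<lambda>z. cayley 1 (?f z / \<sigma>)) holomorphic_on D" by (simp add: o_def)
    show "g (\<sigma> * ((w - 1) / (w + 1))) \<in> D" if "w \<in> rhp" for w
      using ball[OF that] g'(2) by blast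
    show "cayley 1 (?f z / \<sigma>) \<in> rhp" if "z \<in> D" for z
      by (intro cayley_rhp 1 ball' inv that)
    show "cayley 1 (?f (g (\<sigma> * ((w - 1) / (w + 1)))) / \<sigma>) = w" if "w \<in> rhp" for w
      using cayley_of_inverse[OF 1 that] inv(2)[OF ball[OF that]] by simp
    show "g (\<sigma> * ((cayley 1 (?f z / \<sigma>) - 1) / (cayley 1 (?f z / \<sigma>) + 1))) = z" if "z \<in> D" for z
      using cayley_inverse[OF 1 ball'[OF inv(3)[OF that]]] inv(4)[OF that] by simp
  qed
qed

section \<open>The Schwarz lemma and the hyperbolic density\<close>

text \<open>
  This is the only analytic comparison between two domains in the whole proof. If \<open>D\<close> contains the
  image of a disc of radius \<open>r\<close>, then \<open>u \<mapsto> inverse of G (F (r u))\<close> is a self-map of the unit disc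
  that fixes the origin, and the Schwarz lemma bounds its derivative there by 1. With \<open>r = 1\<close> it
  says that densities grow when the domain shrinks and that they do not depend on the Riemann map;
  with \<open>r\<close> close to 1 it says that a large hyperbolic disc around a point, as soon as the subdomain
  contains it, keeps the density of the subdomain at that point below \<open>1 / r\<close> times that of the
  whole domain.
\<close>

lemma schwarz_inclusion:
  assumes F: "F holomorphic_on ball 0 r" and r: "0 < r" and FD: "F ` ball 0 r \<subseteq> D"
    and G: "riemann_map D G" and 0: "F 0 = G 0"
  shows "r * cmod (deriv F 0) \<le> cmod (deriv G 0)"
proof -
  note inv = riemann_map_inverse[OF G]
  let ?k = "the_inv_into (ball 0 1) G"
  let ?f = "?k \<circ> (F \<circ> (\<lambda>u. of_real r * u))"
  have G': "G holomorphic_on ball 0 1" "inj_on G (ball 0 1)" using G by (auto simp: riemann_map_def)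
  have sc: "of_real r * u \<in> ball 0 r" if "u \<in> ball 0 1" for u :: complex
    using that r by (simp add: norm_mult)
  have F1: "F \<circ> (\<lambda>u. of_real r * u) holomorphic_on ball 0 1"
    by (rule holomorphic_on_compose_gen[OF _ F]) (use sc in \<open>auto intro!: holomorphic_intros\<close>)
  have F1D: "(F \<circ> (\<lambda>u. of_real r * u)) ` ball 0 1 \<subseteq> D" using FD sc by force
  have f: "?f holomorphic_on ball 0 1"
    by (rule holomorphic_on_compose_gen[OF F1 inv(1) F1D])
  have "cmod (deriv ?f 0) \<le> 1"
  proof (rule Schwarz_Lemma(2)[OF f, of 0])
    show "?f 0 = 0" using inv(2)[of 0] 0 by simp
    show "cmod (?f z) < 1" if "cmod z < 1" for z
      using inv(3) F1D that by (auto simp: image_subset_iff)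
  qed simp
  have dF: "(F \<circ> (\<lambda>u. of_real r * u) has_field_derivative deriv F 0 * of_real r) (at 0)"
    by (rule DERIV_chain) (use holomorphic_derivI[OF F open_ball, of 0] r in \<open>auto intro!: derivative_eq_intros\<close>)
  have "F 0 \<in> D" using FD r by auto
  have G0: "(G \<circ> ?f has_field_derivative deriv G 0 * deriv ?f 0) (at 0)"
  proof (rule DERIV_chain)
    show "(G has_field_derivative deriv G 0) (at (?f 0))"
      using holomorphic_derivI[OF G'(1) open_ball, of 0] inv(2)[of 0] 0 by simp
    show "(?f has_field_derivative deriv ?f 0) (at 0)"
      by (rule holomorphic_derivI[OF f open_ball]) simp
  qed
  have "((F \<circ> (\<lambda>u. of_real r * u)) has_field_derivative deriv G 0 * deriv ?f 0) (at 0)"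
  proof (rule has_field_derivative_transform_within_open[OF G0 open_ball[of 0 1]])
    show "(G \<circ> ?f) z = (F \<circ> (\<lambda>u. of_real r * u)) z" if "z \<in> ball 0 1" for z
      using inv(4)[of "F (of_real r * z)"] F1D that by (auto simp: image_subset_iff)
  qed simp
  from DERIV_unique[OF this dF] have "deriv F 0 * of_real r = deriv G 0 * deriv ?f 0" by simp
  then have "cmod (deriv F 0) * r = cmod (deriv G 0) * cmod (deriv ?f 0)"
    using r by (metis norm_mult norm_of_real abs_of_pos)
  also have "\<dots> \<le> cmod (deriv G 0)"
    using \<open>cmod (deriv ?f 0) \<le> 1\<close> mult_left_le[of "cmod (deriv ?f 0)" "cmod (deriv G 0)"] by simp
  finally show ?thesis by (simp add: mult.commute)
qed

lemma riemann_map_deriv_0_unique: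
  assumes "riemann_map D F" "riemann_map D G" "F 0 = G 0"
  shows "cmod (deriv F 0) = cmod (deriv G 0)"
  using schwarz_inclusion[of F 1 D G] schwarz_inclusion[of G 1 D F] assms
  by (simp add: riemann_map_def)

text \<open>
  The density is defined by an arbitrary Riemann map at an arbitrary point of the disc; this lemma
  translates its defining quantity \<open>\<bar>g' z\<bar> (1 - \<bar>z\<bar>\<^sup>2)\<close> to the half-plane.
\<close>

lemma half_plane_chart_deriv:
  assumes g: "riemann_map D g" and z: "z \<in> ball 0 1"
  obtains h k w where "half_plane_chart D h k" "w \<in> rhp" "h w = g z"
    "cmod (deriv h w) * (2 * Re w) = cmod (deriv g z) * (1 - (cmod z)\<^sup>2)"
proof
  define h where "h = (\<lambda>w. g (1 * ((w - 1) / (w + 1))))"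
  define w where "w = cayley 1 z"
  have 1: "(1::complex) \<in> rhp" by simp
  show "half_plane_chart D h (\<lambda>z. cayley 1 (the_inv_into (ball 0 1) g z / 1))"
    unfolding h_def by (rule half_plane_chart_of_riemann_map[OF g]) simp
  show w: "w \<in> rhp" unfolding w_def by (rule cayley_rhp[OF 1 z])
  have wz: "(w - 1) / (w + 1) = z" unfolding w_def using cayley_inverse[OF 1 z] by simp
  then show "h w = g z" by (simp add: h_def)
  have z1: "z \<noteq> 1" using z by auto
  have w1: "w + 1 \<noteq> 0" using rhp_add_cnj_neq_0[OF 1 w] by simp
  have "w + 1 = 2 / (1 - z)" unfolding w_def cayley_def using z1 by (simp add: field_simps)
  have d: "((\<lambda>w. (w - 1) / (w + 1)) has_field_derivative (2 / (w + 1)\<^sup>2)) (at w)"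
    using w1 by (auto intro!: derivative_eq_intros simp: power2_eq_square)
  have "g holomorphic_on ball 0 1" using g by (simp add: riemann_map_def)
  from holomorphic_derivI[OF this open_ball z]
  have "(g has_field_derivative deriv g z) (at ((w - 1) / (w + 1)))" unfolding wz .
  from DERIV_chain2[OF this d] have "deriv h w = deriv g z * (2 / (w + 1)\<^sup>2)"
    unfolding h_def by (simp add: DERIV_imp_deriv)
  also have "2 / (w + 1)\<^sup>2 = (1 - z)\<^sup>2 / 2"
    unfolding \<open>w + 1 = 2 / (1 - z)\<close> by (simp add: power_divide)
  finally have "cmod (deriv h w) = cmod (deriv g z * ((1 - z)\<^sup>2 / 2))" by (rule arg_cong)
  then have 1: "cmod (deriv h w) = cmod (deriv g z) * ((cmod (1 - z))\<^sup>2 / 2)"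
    by (simp only: norm_mult norm_divide norm_power norm_numeral)
  have 2: "Re w * (cmod (1 - z))\<^sup>2 = 1 - (cmod z)\<^sup>2"
    unfolding w_def Re_cayley[OF z1] using z1 by simp
  show "cmod (deriv h w) * (2 * Re w) = cmod (deriv g z) * (1 - (cmod z)\<^sup>2)"
    unfolding 1 2[symmetric] by simp
qed

context half_plane_chart
begin

text \<open>
  Every competitor \<open>(g, z)\<close> in the definition of the density gives a Riemann map with centre \<open>h w\<close>, and
  the modulus of the derivative at the origin of such a map is determined by \<open>D\<close> and \<open>h w\<close>.
\<close>

lemma hyp_density_chart:
  assumes w: "w \<in> rhp"
  shows "hyp_density D (h w) = 1 / (2 * Re w * cmod (deriv h w))"
  unfolding hyp_density_def
proof (rule the_equality)
  have pos: "2 * Re w * cmod (deriv h w) > 0" using w deriv_h_nonzero[OF w] by simp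
  have "riemann_map D (h \<circ> cayley w)" "(0::complex) \<in> ball 0 1" "(h \<circ> cayley w) 0 = h w"
    using riemann_map_cayley[OF w] cayley_at_0 by auto
  moreover have "1 / (2 * Re w * cmod (deriv h w)) * cmod (deriv (h \<circ> cayley w) 0) = 1 / (1 - (cmod 0)\<^sup>2)"
    unfolding deriv_h_cayley[OF w] using deriv_h_nonzero[OF w] w by (simp add: norm_mult)
  ultimately show "\<exists>g z. riemann_map D g \<and> z \<in> ball 0 1 \<and> g z = h w \<and>
     1 / (2 * Re w * cmod (deriv h w)) * cmod (deriv g z) = 1 / (1 - (cmod z)\<^sup>2)"
    by blast
  fix l assume "\<exists>g z. riemann_map D g \<and> z \<in> ball 0 1 \<and> g z = h w \<and>
     l * cmod (deriv g z) = 1 / (1 - (cmod z)\<^sup>2)"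
  then obtain g z where gz: "riemann_map D g" "z \<in> ball 0 1" "g z = h w"
    "l * cmod (deriv g z) = 1 / (1 - (cmod z)\<^sup>2)" by blast
  obtain h' k' w' where h': "half_plane_chart D h' k'" "w' \<in> rhp" "h' w' = g z"
    "cmod (deriv h' w') * (2 * Re w') = cmod (deriv g z) * (1 - (cmod z)\<^sup>2)"
    by (rule half_plane_chart_deriv[OF gz(1,2)])
  interpret h': half_plane_chart D h' k' by (rule h')
  have "cmod (deriv (h' \<circ> cayley w') 0) = cmod (deriv (h \<circ> cayley w) 0)"
    by (rule riemann_map_deriv_0_unique)
       (use riemann_map_cayley[OF w] h'.riemann_map_cayley[OF h'(2)] cayley_at_0 h'.cayley_at_0 h'(3) gz(3) in auto)
  then have "cmod (deriv g z) * (1 - (cmod z)\<^sup>2) = 2 * Re w * cmod (deriv h w)"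
    unfolding deriv_h_cayley[OF w] h'.deriv_h_cayley[OF h'(2)] using w h'(2,4)
    by (simp add: norm_mult algebra_simps)
  moreover have "(cmod z)\<^sup>2 < 1" using gz(2) by (simp add: abs_square_less_1)
  then have "l * (cmod (deriv g z) * (1 - (cmod z)\<^sup>2)) = 1"
    using gz(4) by (simp add: field_simps)
  ultimately show "l = 1 / (2 * Re w * cmod (deriv h w))"
    using pos by (simp only: eq_divide_eq) auto
qed

lemma hyp_density_pos: "z \<in> D \<Longrightarrow> 0 < hyp_density D z"
  using hyp_density_chart[OF k_rhp, of z] deriv_h_nonzero[OF k_rhp, of z] k_rhp[of z] h_k[of z] by simp

lemma continuous_hyp_density: "continuous_on D (hyp_density D)"
proof -
  have "continuous_on D k" using hol_k by (rule holomorphic_on_imp_continuous_on)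
  moreover have "continuous_on rhp (deriv h)"
    using holomorphic_deriv[OF hol_h open_rhp] by (rule holomorphic_on_imp_continuous_on)
  ultimately have "continuous_on D (\<lambda>z. deriv h (k z))"
    using continuous_on_compose2[of rhp "deriv h" D k] k_rhp by auto
  then have "continuous_on D (\<lambda>z. 1 / (2 * Re (k z) * cmod (deriv h (k z))))"
    using \<open>continuous_on D k\<close> k_rhp deriv_h_nonzero[OF k_rhp]
    by (intro continuous_intros) fastforce+
  then show ?thesis
    by (rule continuous_on_eq) (metis hyp_density_chart h_k k_rhp)
qed

end

section \<open>Hyperbolic lengths in a chart\<close>

lemma piecewise_C1_holomorphic_compose:
  assumes p: "p piecewise_C1_differentiable_on I" and pU: "p ` I \<subseteq> U"
    and U: "open U" and F: "F holomorphic_on U"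
  shows "(F \<circ> p) piecewise_C1_differentiable_on I"
proof -
  obtain S where S: "finite S" "\<And>t. t \<in> I - S \<Longrightarrow> p differentiable (at t)"
    "continuous_on (I - S) (\<lambda>t. vector_derivative p (at t))" and contp: "continuous_on I p"
    using p unfolding piecewise_C1_differentiable_on_def C1_differentiable_on_eq by blast
  have "continuous_on I (F \<circ> p)"
    using contp continuous_on_subset[OF holomorphic_on_imp_continuous_on[OF F] pU]
    by (rule continuous_on_compose)
  moreover have "(F \<circ> p) C1_differentiable_on (I - S)"
    unfolding C1_differentiable_on_def
  proof (intro exI conjI ballI)
    show "((F \<circ> p) has_vector_derivative vector_derivative p (at t) * deriv F (p t)) (at t)"
      if "t \<in> I - S" for t
    proof (rule field_vector_diff_chain_at)
      show "(p has_vector_derivative vector_derivative p (at t)) (at t)"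
        using S(2)[OF that] by (simp add: vector_derivative_works)
      show "(F has_field_derivative deriv F (p t)) (at (p t))"
        by (rule holomorphic_derivI[OF F U]) (use that pU in auto)
    qed
    have "continuous_on U (deriv F)"
      using holomorphic_deriv[OF F U] by (rule holomorphic_on_imp_continuous_on)
    then have "continuous_on (I - S) (\<lambda>t. deriv F (p t))"
      by (rule continuous_on_compose2) (use contp pU in \<open>auto intro: continuous_on_subset\<close>)
    with S(3) show "continuous_on (I - S) (\<lambda>t. vector_derivative p (at t) * deriv F (p t))"
      by (intro continuous_intros)
  qed
  ultimately show ?thesis using S(1) unfolding piecewise_C1_differentiable_on_def by blast
qed

context half_plane_chart
begin

lemma hyp_speed_h:
  assumes w: "(w has_vector_derivative w') (at t)" and wt: "w t \<in> rhp"
  shows "hyp_speed D (h \<circ> w) t = cmod w' / (2 * Re (w t))"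
proof -
  have "((h \<circ> w) has_vector_derivative (w' * deriv h (w t))) (at t)"
    by (rule field_vector_diff_chain_at[OF w holomorphic_derivI[OF hol_h open_rhp wt]])
  then have "vector_derivative (h \<circ> w) (at t) = w' * deriv h (w t)" by (rule vector_derivative_at)
  then show ?thesis
    using deriv_h_nonzero[OF wt] hyp_density_chart[OF wt] by (simp add: hyp_speed_def norm_mult)
qed

lemma has_vector_derivative_k:
  assumes "(p has_vector_derivative p') (at t)" "p t \<in> D"
  shows "((k \<circ> p) has_vector_derivative (p' * deriv k (p t))) (at t)"
  by (rule field_vector_diff_chain_at[OF assms(1) holomorphic_derivI[OF hol_k open_D assms(2)]])

text \<open>
  The speed is a two-sided derivative, so the curve must agree with \<open>q\<close> on a neighbourhood of \<open>t\<close>;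
  this matters because \<open>h (k z) = z\<close> is known for points of \<open>D\<close> only.
\<close>

lemma hyp_speed_cong:
  assumes "open U" "t \<in> U" "\<And>s. s \<in> U \<Longrightarrow> p s = q s"
  shows "hyp_speed D p t = hyp_speed D q t"
proof -
  have "(p has_vector_derivative v) (at t) \<longleftrightarrow> (q has_vector_derivative v) (at t)" for v
    using has_vector_derivative_transform_within_open[OF _ assms(1,2)] assms(3) by metis
  then show ?thesis using assms(2,3) by (simp add: hyp_speed_def vector_derivative_def)
qed

lemma hyp_speed_k:
  assumes p: "(p has_vector_derivative p') (at t)" and pt: "p t \<in> D"
  shows "hyp_speed D p t = cmod (p' * deriv k (p t)) / (2 * Re (k (p t)))"
proof -
  note w = has_vector_derivative_k[OF p pt]
  have "((h \<circ> (k \<circ> p)) has_vector_derivative (p' * deriv k (p t) * deriv h (k (p t)))) (at t)"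
    using field_vector_diff_chain_at[OF w] holomorphic_derivI[OF hol_h open_rhp k_rhp[OF pt]] by simp
  moreover obtain U where U: "open U" "t \<in> U" "p ` U \<subseteq> D"
  proof -
    have "continuous (at t) p" using p by (rule has_vector_derivative_continuous)
    then have "\<forall>\<^sub>F s in nhds t. p s \<in> D"
      using open_D pt by (simp add: continuous_at tendsto_at_iff_tendsto_nhds topological_tendstoD)
    then show ?thesis using that unfolding eventually_nhds by (auto simp: image_subset_iff)
  qed
  ultimately show ?thesis
    using hyp_speed_cong[OF U(1,2), of p "h \<circ> (k \<circ> p)"] hyp_speed_h[OF w] h_k k_rhp[OF pt]
    by (simp add: image_subset_iff)
qed

lemma hyp_speed_nonneg: "p t \<in> D \<Longrightarrow> 0 \<le> hyp_speed D p t"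
  using hyp_density_pos[of "p t"] by (simp add: hyp_speed_def)

text \<open>
  All comparisons of distances go through this lemma: a curve whose speed is dominated, off a finite
  set, by an integrable function has integrable speed. The point is measurability, which holds because
  the density is continuous and the derivative of the curve is continuous off a finite set.
\<close>

lemma hyp_rectifiable_majorant:
  assumes pD: "p ` {a..b} \<subseteq> D" and p: "p piecewise_C1_differentiable_on {a..b}"
    and f: "f integrable_on {a..b}" and S: "finite S"
    and le: "\<And>t. t \<in> {a..b} - S \<Longrightarrow> hyp_speed D p t \<le> f t"
  shows "hyp_rectifiable D p a b" and "hyp_length D p a b \<le> integral {a..b} f"
proof -
  obtain S' where S': "finite S'" "continuous_on ({a..b} - S') (\<lambda>t. vector_derivative p (at t))"
    and contp: "continuous_on {a..b} p"
    using p unfolding piecewise_C1_differentiable_on_def C1_differentiable_on_eq by blast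
  define T where "T = S \<union> S'"
  have T: "finite T" "negligible T" unfolding T_def using S S' by auto
  have spike: "g integrable_on {a..b} - T \<longleftrightarrow> g integrable_on {a..b}" for g :: "real \<Rightarrow> real"
    by (rule integrable_spike_set_eq) (use T in \<open>auto intro: negligible_subset\<close>)
  have "continuous_on ({a..b} - T) (hyp_speed D p)"
    unfolding hyp_speed_def
  proof (intro continuous_intros)
    show "continuous_on ({a..b} - T) (\<lambda>t. hyp_density D (p t))"
      by (rule continuous_on_compose2[OF continuous_hyp_density])
         (use contp pD in \<open>auto intro: continuous_on_subset\<close>)
    show "continuous_on ({a..b} - T) (\<lambda>t. vector_derivative p (at t))"
      using S'(2) by (rule continuous_on_subset) (auto simp: T_def)
  qed
  moreover have meas: "{a..b} - T \<in> sets lebesgue"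
    using T by (intro sets.Diff) (auto simp: negligible_imp_sets)
  ultimately have "hyp_speed D p \<in> borel_measurable (lebesgue_on ({a..b} - T))"
    by (rule continuous_imp_measurable_on_sets_lebesgue)
  then have "hyp_speed D p integrable_on {a..b} - T"
  proof (rule measurable_bounded_by_integrable_imp_integrable_real[OF _ _ _ meas])
    show "f integrable_on {a..b} - T" using f spike by simp
    show "\<bar>hyp_speed D p t\<bar> \<le> f t" if "t \<in> {a..b} - T" for t
    proof -
      have "p t \<in> D" using pD that by auto
      then show ?thesis using le[of t] hyp_speed_nonneg[of p t] that by (auto simp: T_def)
    qed
  qed
  then have int: "hyp_speed D p integrable_on {a..b}" using spike by simp
  then show "hyp_rectifiable D p a b" using pD p by (simp add: hyp_rectifiable_def)
  let ?f = "\<lambda>t. if t \<in> T then hyp_speed D p t else f t"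
  have "integral {a..b} (hyp_speed D p) \<le> integral {a..b} ?f"
  proof (rule integral_le[OF int])
    show "?f integrable_on {a..b}"
      by (rule integrable_spike[OF f T(2)]) auto
    show "hyp_speed D p t \<le> ?f t" if "t \<in> {a..b}" for t
      using le[of t] that by (auto simp: T_def)
  qed
  also have "\<dots> = integral {a..b} f" by (rule integral_spike[OF T(2)]) auto
  finally show "hyp_length D p a b \<le> integral {a..b} f" by (simp add: hyp_length_def)
qed

lemma hyp_length_nonneg: "hyp_rectifiable D p a b \<Longrightarrow> 0 \<le> hyp_length D p a b"
  unfolding hyp_length_def hyp_rectifiable_def
  by (intro integral_nonneg) (auto intro!: hyp_speed_nonneg)

lemma hyp_dist_le_length:
  assumes "hyp_rectifiable D p 0 1" "p 0 = z" "p 1 = w"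
  shows "hyp_dist D z w \<le> hyp_length D p 0 1"
  unfolding hyp_dist_def
  by (rule cInf_lower) (use assms hyp_length_nonneg in \<open>auto intro!: bdd_belowI[of _ 0]\<close>)

section \<open>The hyperbolic distance in a chart\<close>

text \<open>
  The distance is computed first between two points of the positive real axis, where the Euclidean
  segment is optimal; \<open>hyp_length_ge_ln_Re\<close> shows that no curve is shorter.
\<close>

lemma real_segment:
  assumes "1 \<le> x"
  obtains p where "hyp_rectifiable D p 0 1" "p 0 = h 1" "p 1 = h (of_real x)"
    "hyp_length D p 0 1 \<le> ln x / 2"
proof
  define w :: "real \<Rightarrow> complex" where "w t = of_real (1 + t * (x - 1))" for t
  have Re_w: "1 \<le> Re (w t)" if "t \<in> {0..1}" for t
    using that assms by (simp add: w_def)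
  have w': "(w has_vector_derivative of_real (x - 1)) (at t)" for t
    unfolding w_def by (auto intro!: derivative_eq_intros)
  have hw: "(h \<circ> w) piecewise_C1_differentiable_on {0..1}"
  proof (rule piecewise_C1_holomorphic_compose[OF _ _ open_rhp hol_h])
    show "w piecewise_C1_differentiable_on {0..1}"
      by (rule C1_differentiable_imp_piecewise)
         (use w' in \<open>auto simp: C1_differentiable_on_def intro!: exI[of _ "\<lambda>_. of_real (x - 1)"]\<close>)
    show "w ` {0..1} \<subseteq> rhp" using Re_w by fastforce
  qed
  have int: "((\<lambda>t. (x - 1) / (2 * (1 + t * (x - 1)))) has_integral (ln (1 + 1 * (x - 1)) / 2 - ln (1 + 0 * (x - 1)) / 2)) {0..1}"
  proof (rule fundamental_theorem_of_calculus)
    fix t :: real assume "t \<in> {0..1}"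
    have aff: "((\<lambda>t. 1 + t * (x - 1)) has_real_derivative (x - 1)) (at t within {0..1})" for t
      by (auto intro!: derivative_eq_intros)
    have "0 < 1 + t * (x - 1)" using Re_w[of t] \<open>t \<in> {0..1}\<close> by (simp add: w_def)
    then show "((\<lambda>t. ln (1 + t * (x - 1)) / 2) has_vector_derivative (x - 1) / (2 * (1 + t * (x - 1)))) (at t within {0..1})"
      unfolding has_real_derivative_iff_has_vector_derivative[symmetric]
      by (intro DERIV_cong[OF DERIV_cdivide[OF DERIV_chain2[OF DERIV_ln aff], of t 2]]) (simp_all add: field_simps)
  qed simp
  have spd: "hyp_speed D (h \<circ> w) t \<le> (x - 1) / (2 * (1 + t * (x - 1)))" if "t \<in> {0..1} - {}" for t
  proof -
    have "1 \<le> Re (w t)" using Re_w[of t] that by simp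
    moreover have "Re (w t) = 1 + t * (x - 1)" by (simp add: w_def)
    ultimately show ?thesis
      using hyp_speed_h[OF w', of t] assms by (simp del: of_real_diff)
  qed
  have D: "(h \<circ> w) ` {0..1} \<subseteq> D" using h_D Re_w by fastforce
  note maj = hyp_rectifiable_majorant[OF D hw has_integral_integrable[OF int] finite.emptyI spd]
  show "hyp_rectifiable D (h \<circ> w) 0 1" by (rule maj(1))
  show "hyp_length D (h \<circ> w) 0 1 \<le> ln x / 2"
    using maj(2) integral_unique[OF int] by simp
  show "(h \<circ> w) 0 = h 1" "(h \<circ> w) 1 = h (of_real x)" by (simp_all add: w_def)
qed

text \<open>
  The function \<open>w \<mapsto> ln (Re w) / 2\<close> has gradient of norm exactly \<open>1 / (2 Re w)\<close>, the density of the
  half-plane, so along a curve it cannot grow faster than the length.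
\<close>

lemma hyp_length_ge_ln_Re:
  assumes p: "hyp_rectifiable D p a b" and "a \<le> b"
  shows "ln (Re (k (p b))) / 2 - ln (Re (k (p a))) / 2 \<le> hyp_length D p a b"
proof -
  have pD: "p t \<in> D" if "t \<in> {a..b}" for t using p that by (auto simp: hyp_rectifiable_def)
  have rect: "p piecewise_C1_differentiable_on {a..b}" "hyp_speed D p integrable_on {a..b}"
    using p by (auto simp: hyp_rectifiable_def)
  then obtain S where S: "finite S" "\<And>t. t \<in> {a..b} - S \<Longrightarrow> p differentiable (at t)"
    and contp: "continuous_on {a..b} p"
    unfolding piecewise_C1_differentiable_on_def C1_differentiable_on_eq by blast
  define v where "v t = vector_derivative p (at t) * deriv k (p t)" for t
  \<comment> \<open>At the exceptional points the integrand is set to the speed, so that the bound by the speed holds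
    on the whole interval.\<close>
  define f' where "f' t = (if t \<in> S then hyp_speed D p t else Re (v t) / (2 * Re (k (p t))))" for t
  have der: "((k \<circ> p) has_vector_derivative v t) (at t)" "hyp_speed D p t = cmod (v t) / (2 * Re (k (p t)))"
    if "t \<in> {a..b} - S" for t
    unfolding v_def
    using S(2)[OF that] pD[of t] that has_vector_derivative_k hyp_speed_k
    by (auto simp: vector_derivative_works)
  have "(f' has_integral (ln (Re (k (p b))) / 2 - ln (Re (k (p a))) / 2)) {a..b}"
  proof (rule fundamental_theorem_of_calculus_strong[OF S(1) \<open>a \<le> b\<close>])
    fix t assume t: "t \<in> {a..b} - S"
    have "((\<lambda>t. Re ((k \<circ> p) t)) has_vector_derivative Re (v t)) (at t)"
      by (rule bounded_linear.has_vector_derivative[OF bounded_linear_Re der(1)[OF t]])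
    then have "((\<lambda>t. Re (k (p t))) has_real_derivative Re (v t)) (at t)"
      by (simp add: has_real_derivative_iff_has_vector_derivative)
    from DERIV_cdivide[OF DERIV_chain2[OF DERIV_ln this], of 2]
    show "((\<lambda>t. ln (Re (k (p t))) / 2) has_vector_derivative f' t) (at t)"
      unfolding has_real_derivative_iff_has_vector_derivative[symmetric] f'_def
      using k_rhp[of "p t"] pD[of t] t by (simp add: field_simps)
  next
    have "continuous_on {a..b} (\<lambda>t. k (p t))"
      by (rule continuous_on_compose2[OF holomorphic_on_imp_continuous_on[OF hol_k] contp]) (use pD in auto)
    then show "continuous_on {a..b} (\<lambda>t. ln (Re (k (p t))) / 2)"
      using k_rhp pD by (intro continuous_intros) fastforce+
  qed
  moreover have "(hyp_speed D p has_integral hyp_length D p a b) {a..b}"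
    using rect(2) by (simp add: hyp_length_def has_integral_integral)
  ultimately show ?thesis
  proof (rule has_integral_le)
    fix t assume t: "t \<in> {a..b}"
    then show "f' t \<le> hyp_speed D p t"
      using der(2)[of t] k_rhp[OF pD[OF t]] complex_Re_le_cmod[of "v t"]
      by (auto simp: f'_def divide_right_mono)
  qed
qed

lemma hyp_dist_real:
  assumes "1 \<le> x"
  shows "hyp_dist D (h 1) (h (of_real x)) = ln x / 2"
proof (rule antisym)
  obtain p where p: "hyp_rectifiable D p 0 1" "p 0 = h 1" "p 1 = h (of_real x)"
    "hyp_length D p 0 1 \<le> ln x / 2"
    by (rule real_segment[OF assms])
  then show "hyp_dist D (h 1) (h (of_real x)) \<le> ln x / 2"
    using hyp_dist_le_length[OF p(1-3)] by linarith
  show "ln x / 2 \<le> hyp_dist D (h 1) (h (of_real x))"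
    unfolding hyp_dist_def
  proof (rule cInf_greatest)
    show "{hyp_length D p 0 1 |p. hyp_rectifiable D p 0 1 \<and> p 0 = h 1 \<and> p 1 = h (of_real x)} \<noteq> {}"
      using p by blast
    show "ln x / 2 \<le> l" if l: "l \<in> {hyp_length D p 0 1 |p. hyp_rectifiable D p 0 1 \<and> p 0 = h 1 \<and> p 1 = h (of_real x)}" for l
    proof -
      obtain p where p: "l = hyp_length D p 0 1" "hyp_rectifiable D p 0 1" "p 0 = h 1" "p 1 = h (of_real x)"
        using l by auto
      show ?thesis using hyp_length_ge_ln_Re[OF p(2)] p(1,3,4) assms k_h[of 1] k_h[of "of_real x"] by simp
    qed
  qed
qed

text \<open>
  Any two points can be moved to 1 and to a real \<open>x \<ge> 1\<close>: the Cayley map puts the first point at the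
  origin of the disc, a rotation puts the second one on the positive radius. This reduces the general
  distance formula to \<open>hyp_dist_real\<close>.
\<close>

lemma normalized_chart:
  assumes w0: "w0 \<in> rhp" and w: "w \<in> rhp"
  obtains h' k' x where "half_plane_chart D h' k'" "1 \<le> x" "h' 1 = h w0" "h' (of_real x) = h w"
    "x = (1 + pseudo_dist w0 w) / (1 - pseudo_dist w0 w)"
proof -
  define \<rho> where "\<rho> = pseudo_dist w0 w"
  have \<rho>: "0 \<le> \<rho>" "\<rho> < 1" unfolding \<rho>_def by (rule pseudo_dist_bounds[OF w0 w])+
  define z where "z = (w - w0) / (w + cnj w0)"
  have z: "cmod z = \<rho>" by (simp add: z_def \<rho>_def pseudo_dist_def)
  define \<sigma> where "\<sigma> = (if z = 0 then 1 else sgn z)"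
  have \<sigma>: "cmod \<sigma> = 1" "\<sigma> * of_real \<rho> = z"
    using z by (auto simp: \<sigma>_def norm_sgn) (simp add: sgn_eq)
  define x where "x = (1 + \<rho>) / (1 - \<rho>)"
  note chart = half_plane_chart_of_riemann_map[OF riemann_map_cayley[OF w0] \<sigma>(1)]
  have "x + 1 \<noteq> 0" "(x - 1) / (x + 1) = \<rho>" using \<rho> by (simp_all add: x_def field_simps)
  then have x': "(of_real x - 1) / (of_real x + 1) = (of_real \<rho> :: complex)"
    by (metis of_real_1 of_real_add of_real_diff of_real_divide)
  show ?thesis
  proof (rule that[OF chart, of x])
    show "1 \<le> x" using \<rho> by (simp add: x_def field_simps)
    show "(h \<circ> cayley w0) (\<sigma> * ((1 - 1) / (1 + 1))) = h w0" by (simp add: cayley_def)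
    show "(h \<circ> cayley w0) (\<sigma> * ((of_real x - 1) / (of_real x + 1))) = h w"
      unfolding x' \<sigma>(2) z_def using cayley_of_inverse[OF w0 w] by simp
  qed (simp add: x_def \<rho>_def)
qed

lemma hyp_dist_h:
  assumes "w0 \<in> rhp" "w \<in> rhp"
  shows "hyp_dist D (h w0) (h w) = artanh (pseudo_dist w0 w)"
proof -
  obtain h' k' x where c: "half_plane_chart D h' k'" "1 \<le> x" "h' 1 = h w0" "h' (of_real x) = h w"
    "x = (1 + pseudo_dist w0 w) / (1 - pseudo_dist w0 w)"
    by (rule normalized_chart[OF assms])
  show ?thesis
    using half_plane_chart.hyp_dist_real[OF c(1,2)] c(3-5) by (simp add: artanh_def)
qed

lemma rectifiable_path_exists:
  assumes "z \<in> D" "w \<in> D"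
  obtains p where "hyp_rectifiable D p 0 1" "p 0 = z" "p 1 = w"
proof -
  obtain h' k' x where c: "half_plane_chart D h' k'" "1 \<le> x" "h' 1 = h (k z)" "h' (of_real x) = h (k w)"
    "x = (1 + pseudo_dist (k z) (k w)) / (1 - pseudo_dist (k z) (k w))"
    by (rule normalized_chart[OF k_rhp[OF assms(1)] k_rhp[OF assms(2)]])
  obtain p where p: "hyp_rectifiable D p 0 1" "p 0 = h' 1" "p 1 = h' (of_real x)"
    by (rule half_plane_chart.real_segment[OF c(1,2)])
  show ?thesis
  proof (rule that[OF p(1)])
    show "p 0 = z" "p 1 = w" using p c(3,4) h_k assms by auto
  qed
qed

lemma hyp_dist_nonneg:
  assumes "z \<in> D" "w \<in> D"
  shows "0 \<le> hyp_dist D z w"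
  unfolding hyp_dist_def
proof (rule cInf_greatest)
  obtain p where "hyp_rectifiable D p 0 1" "p 0 = z" "p 1 = w"
    by (rule rectifiable_path_exists[OF assms])
  then show "{hyp_length D p 0 1 |p. hyp_rectifiable D p 0 1 \<and> p 0 = z \<and> p 1 = w} \<noteq> {}"
    by blast
qed (auto intro: hyp_length_nonneg)

end

section \<open>Geodesic rays that land at infinity\<close>

lemma pseudo_dist_commute: "pseudo_dist w0 w = pseudo_dist w w0"
proof -
  have "cmod (w + cnj w0) = cmod (cnj (w + cnj w0))" by (rule complex_mod_cnj[symmetric])
  also have "\<dots> = cmod (w0 + cnj w)" by (simp add: add.commute)
  finally show ?thesis by (simp add: pseudo_dist_def norm_divide norm_minus_commute)
qed

lemma pseudo_dist_tendsto_1: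
  assumes "filterlim w at_infinity F"
  shows "((\<lambda>t. pseudo_dist u (w t)) \<longlongrightarrow> 1) F"
    and "((\<lambda>t. cmod ((w t + cnj u) / (w t + cnj v))) \<longlongrightarrow> 1) F"
proof -
  have lim: "((\<lambda>t. cmod ((w t + a) / (w t + b))) \<longlongrightarrow> 1) F" for a b
  proof -
    have inf: "filterlim (\<lambda>t. w t + b) at_infinity F"
      by (rule tendsto_add_filterlim_at_infinity'[OF assms tendsto_const])
    have "((\<lambda>t. 1 + (a - b) / (w t + b)) \<longlongrightarrow> 1 + 0) F"
      by (intro tendsto_intros tendsto_divide_0[OF tendsto_const inf])
    moreover have "\<forall>\<^sub>F t in F. 1 + (a - b) / (w t + b) = (w t + a) / (w t + b)"
      using filterlim_at_infinity_imp_eventually_ne[OF inf, of 0]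
      by eventually_elim (simp add: field_simps)
    ultimately have "((\<lambda>t. (w t + a) / (w t + b)) \<longlongrightarrow> 1) F"
      using tendsto_cong by fastforce
    then show ?thesis using tendsto_norm by fastforce
  qed
  show "((\<lambda>t. pseudo_dist u (w t)) \<longlongrightarrow> 1) F"
    using lim[of "- u" "cnj u"] by (simp add: pseudo_dist_def)
  show "((\<lambda>t. cmod ((w t + cnj u) / (w t + cnj v))) \<longlongrightarrow> 1) F" by (rule lim)
qed

text \<open>
  The left-hand side is the exponential of twice the hyperbolic distance. The right-hand side isolates
  the factor \<open>1 / Re u\<close> from factors that have the same behaviour for all \<open>u\<close> when \<open>w\<close> tends to infinity.
\<close>

lemma pseudo_dist_ratio:
  assumes "u \<in> rhp" "w \<in> rhp"
  shows "(1 + pseudo_dist u w) / (1 - pseudo_dist u w)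
    = (1 + pseudo_dist u w)\<^sup>2 * (cmod (w + cnj u))\<^sup>2 / (4 * Re u * Re w)"
proof -
  define \<rho> where "\<rho> = pseudo_dist u w"
  have \<rho>: "0 \<le> \<rho>" "\<rho> < 1" unfolding \<rho>_def using pseudo_dist_bounds[OF assms] by auto
  have "(1 + \<rho>) / (1 - \<rho>) = (1 + \<rho>)\<^sup>2 / (1 - \<rho>\<^sup>2)"
  proof -
    have "1 - \<rho>\<^sup>2 = (1 + \<rho>) * (1 - \<rho>)" by (simp add: power2_eq_square algebra_simps)
    then show ?thesis using \<rho> by (simp add: power2_eq_square)
  qed
  also have "1 - \<rho>\<^sup>2 = 4 * Re u * Re w / (cmod (w + cnj u))\<^sup>2"
    unfolding \<rho>_def by (rule one_minus_pseudo_dist[OF assms])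
  finally show ?thesis by (simp add: \<rho>_def)
qed

lemma artanh_less:
  fixes x y :: real
  assumes "0 \<le> x" "x < y" "y < 1"
  shows "artanh x < artanh y"
proof -
  have "(1 + x) / (1 - x) < (1 + y) / (1 - y)" using assms by (simp add: divide_simps) (simp add: algebra_simps)
  moreover have "0 < (1 + x) / (1 - x)" using assms by simp
  ultimately show ?thesis unfolding artanh_def by simp
qed

lemma less_tanh_of_artanh_less:
  fixes x R :: real
  assumes "0 \<le> x" "x < 1" "artanh x < R"
  shows "x < tanh R"
proof (rule ccontr)
  assume "\<not> x < tanh R"
  moreover have "0 \<le> artanh x" unfolding artanh_def using assms by simp
  then have "0 \<le> tanh R" using assms(3) by simp
  ultimately have "artanh (tanh R) \<le> artanh x"
    using artanh_less[of "tanh R" x] assms(2) by (cases "tanh R = x") auto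
  then show False using assms(3) by (simp add: artanh_tanh_real)
qed

context half_plane_chart
begin

lemma geodesic_additive:
  assumes geo: "hyp_geodesic_on D {0..} \<gamma>" and "0 \<le> s" "s \<le> t"
  shows "hyp_dist D (\<gamma> 0) (\<gamma> t) = hyp_dist D (\<gamma> 0) (\<gamma> s) + hyp_dist D (\<gamma> s) (\<gamma> t)"
proof -
  have *: "hyp_rectifiable D \<gamma> a b" "hyp_length D \<gamma> a b = hyp_dist D (\<gamma> a) (\<gamma> b)" if "0 \<le> a" "a \<le> b" for a b
    using geo that by (auto simp: hyp_geodesic_on_def)
  have "hyp_speed D \<gamma> integrable_on {0..t}"
    using *(1)[of 0 t] assms by (simp add: hyp_rectifiable_def)
  then have "hyp_length D \<gamma> 0 s + hyp_length D \<gamma> s t = hyp_length D \<gamma> 0 t"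
    unfolding hyp_length_def using assms by (intro Henstock_Kurzweil_Integration.integral_combine)
  then show ?thesis using *(2)[of 0 s] *(2)[of s t] *(2)[of 0 t] assms by simp
qed

text \<open>
  Along a geodesic \<open>d(\<gamma> 0, \<gamma> t) - d(\<gamma> s, \<gamma> t)\<close> equals \<open>d(\<gamma> 0, \<gamma> s)\<close> for all \<open>t \<ge> s\<close>. When
  \<open>\<gamma> t\<close> tends to infinity the difference converges to the Busemann function of the point at infinity,
  which is \<open>ln (y / x) / 2\<close> for the real parts \<open>x\<close> and \<open>y\<close> of \<open>\<gamma> 0\<close> and \<open>\<gamma> s\<close>. So the distance of
  \<open>\<gamma> 0\<close> and \<open>\<gamma> s\<close> is as small as their real parts permit, and this forces equal imaginary parts.
\<close>

lemma geodesic_ray_horizontal: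
  assumes geo: "hyp_geodesic_on D {0..} \<gamma>"
    and lim: "filterlim (\<lambda>t. k (\<gamma> t)) at_infinity at_top" and s: "0 \<le> s"
  shows "Im (k (\<gamma> s)) = Im (k (\<gamma> 0))"
proof -
  define w where "w t = k (\<gamma> t)" for t
  define E where "E a b = (1 + pseudo_dist (w a) (w b)) / (1 - pseudo_dist (w a) (w b))" for a b
  have \<gamma>D: "\<gamma> t \<in> D" if "0 \<le> t" for t using geo that by (auto simp: hyp_geodesic_on_def)
  have w: "w t \<in> rhp" if "0 \<le> t" for t unfolding w_def by (rule k_rhp[OF \<gamma>D[OF that]])
  have Epos: "0 < E a b" if "0 \<le> a" "0 \<le> b" for a b
    unfolding E_def using pseudo_dist_bounds[OF w[OF that(1)] w[OF that(2)]] by simp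
  have dist: "hyp_dist D (\<gamma> a) (\<gamma> b) = ln (E a b) / 2" if "0 \<le> a" "0 \<le> b" for a b
    using hyp_dist_h[OF w[OF that(1)] w[OF that(2)]] \<gamma>D that h_k
    by (simp add: artanh_def E_def w_def)
  have E_mult: "E 0 t = E 0 s * E s t" if "s \<le> t" for t
  proof -
    have "ln (E 0 t) = ln (E 0 s) + ln (E s t)"
      using geodesic_additive[OF geo s that] dist s that by simp
    also have "\<dots> = ln (E 0 s * E s t)" using Epos s that by (simp add: ln_mult_pos)
    finally show ?thesis using Epos s that by simp
  qed
  \<comment> \<open>\<open>E 0 t / E s t\<close> written with \<open>pseudo_dist_ratio\<close>: the factor \<open>Re (w t)\<close> cancels and what remains
    converges.\<close>
  define Q where "Q t = Re (w s) / Re (w 0) * ((1 + pseudo_dist (w 0) (w t)) / (1 + pseudo_dist (w s) (w t)))\<^sup>2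
      * (cmod ((w t + cnj (w 0)) / (w t + cnj (w s))))\<^sup>2" for t
  have EQ: "E 0 s = Q t" if "s \<le> t" for t
  proof -
    have t0: "0 \<le> t" using s that by simp
    note r = pseudo_dist_ratio[OF w w, folded E_def]
    have ne: "Re (w 0) > 0" "Re (w t) > 0" "Re (w s) > 0" "cmod (w t + cnj (w s)) > 0"
      using w[of 0] w[of t] w[of s] rhp_add_cnj_neq_0[of "w s" "w t"] s t0 by auto
    have "E 0 s = E 0 t / E s t" using E_mult[OF that] Epos[OF s t0] by simp
    also have "\<dots> = Q t"
    proof -
      have frac: "A / (4 * x * z) / (B / (4 * y * z)) = y / x * (A / B)"
        if "0 < x" "0 < y" "0 < z" for A B x y z :: real
        using that by (simp add: field_simps)
      show ?thesis
        unfolding Q_def r[OF order_refl t0] r[OF s t0] frac[OF ne(1,3,2)]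
        by (simp add: norm_divide power_divide)
    qed
    finally show ?thesis .
  qed
  have "\<forall>\<^sub>F t in at_top. Q t = E 0 s"
    using eventually_ge_at_top[of s] by eventually_elim (simp add: EQ)
  then have "(Q \<longlongrightarrow> E 0 s) at_top" by (rule tendsto_eventually)
  moreover have "(Q \<longlongrightarrow> Re (w s) / Re (w 0) * ((1 + 1) / (1 + 1))\<^sup>2 * 1\<^sup>2) at_top"
    unfolding Q_def using lim[folded w_def]
    by (intro tendsto_intros pseudo_dist_tendsto_1) auto
  ultimately have Es: "E 0 s = Re (w s) / Re (w 0)"
    using tendsto_unique[OF trivial_limit_at_top_linorder] by fastforce
  define x y \<rho> where "x = Re (w 0)" and "y = Re (w s)" and "\<rho> = pseudo_dist (w 0) (w s)"
  have xy: "0 < x" "0 < y" using w[of 0] w[of s] s by (auto simp: x_def y_def)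
  have \<rho>: "0 \<le> \<rho>" "\<rho> < 1" unfolding \<rho>_def using pseudo_dist_bounds w s by auto
  have "(1 + \<rho>) * x = y * (1 - \<rho>)"
    using Es \<rho> xy unfolding E_def x_def[symmetric] y_def[symmetric] \<rho>_def[symmetric]
    by (simp add: divide_simps)
  then have "\<rho> * (x + y) = y - x" by (simp add: algebra_simps)
  then have "\<rho> = (y - x) / (x + y)" using xy by (simp add: field_simps)
  then have "1 - \<rho>\<^sup>2 = ((x + y)\<^sup>2 - (y - x)\<^sup>2) / (x + y)\<^sup>2"
    using xy by (simp only: power_divide diff_divide_distrib[of "(x + y)\<^sup>2"]) simp
  also have "(x + y)\<^sup>2 - (y - x)\<^sup>2 = 4 * x * y" by (simp add: power2_eq_square algebra_simps)
  finally have "4 * x * y / (x + y)\<^sup>2 = 4 * x * y / (cmod (w s + cnj (w 0)))\<^sup>2"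
    using one_minus_pseudo_dist[OF w w, of 0 s] s by (auto simp: x_def y_def \<rho>_def)
  then have "(cmod (w s + cnj (w 0)))\<^sup>2 = (x + y)\<^sup>2"
    using xy rhp_add_cnj_neq_0[OF w w, of 0 s] s by (auto simp: divide_simps)
  then have "(Im (w s) - Im (w 0))\<^sup>2 = 0"
    unfolding cmod_power2 by (simp add: x_def y_def add.commute)
  then show ?thesis by (simp add: w_def)
qed

end

text \<open>
  The two landing statements may use different Riemann maps \<open>g\<close> and \<open>g'\<close>. Their boundary extensions
  \<open>G\<close> and \<open>G'\<close> are homeomorphisms onto the same space, so the composition of \<open>G\<close> with the inverse of
  \<open>G'\<close> is a homeomorphism of the closed disc. It extends the transition map of \<open>g\<close> and \<open>g'\<close> and takes
  the point over \<open>\<zeta>\<close> to the point over \<open>\<zeta>\<close>.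
\<close>

lemma lands_at_common_riemann_map:
  assumes \<gamma>: "lands_at D \<gamma> \<zeta>" "\<gamma> ` {0..} \<subseteq> D" and \<gamma>': "lands_at D \<gamma>' \<zeta>"
  obtains g \<sigma> where "riemann_map D g" "cmod \<sigma> = 1"
    "((\<lambda>t. the_inv_into (ball 0 1) g (\<gamma> t)) \<longlongrightarrow> \<sigma>) at_top"
    "((\<lambda>t. the_inv_into (ball 0 1) g (\<gamma>' t)) \<longlongrightarrow> \<sigma>) at_top"
proof -
  obtain g G \<sigma> where g: "riemann_map D g" "boundary_extension D g G" "\<sigma> \<in> sphere 0 1" "G \<sigma> = Inr \<zeta>"
    and lim: "((\<lambda>t. the_inv_into (ball 0 1) g (\<gamma> t)) \<longlongrightarrow> \<sigma>) at_top"
    using \<gamma>(1) unfolding lands_at_def by blast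
  obtain g' G' \<sigma>' where g': "riemann_map D g'" "boundary_extension D g' G'" "\<sigma>' \<in> sphere 0 1" "G' \<sigma>' = Inr \<zeta>"
    and lim': "((\<lambda>t. the_inv_into (ball 0 1) g' (\<gamma>' t)) \<longlongrightarrow> \<sigma>') at_top"
    using \<gamma>' unfolding lands_at_def by blast
  let ?X = "top_of_set (cball (0::complex) 1)" and ?Y = "caratheodory_topology D"
  let ?k = "the_inv_into (ball 0 1) g" and ?k' = "the_inv_into (ball 0 1) g'"
  note inv = riemann_map_inverse[OF g(1)] and inv' = riemann_map_inverse[OF g'(1)]
  have "homeomorphic_map ?X ?Y G'" using g'(2) by (simp add: boundary_extension_def)
  then obtain H where "homeomorphic_maps ?X ?Y G' H" by (auto simp: homeomorphic_map_maps)
  then have H: "continuous_map ?Y ?X H" "\<And>z. z \<in> cball 0 1 \<Longrightarrow> H (G' z) = z"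
    by (auto simp: homeomorphic_maps_def)
  have "continuous_map ?X ?Y G"
    using g(2) by (auto simp: boundary_extension_def intro: homeomorphic_imp_continuous_map)
  from continuous_map_compose[OF this H(1)] have m: "continuous_on (cball 0 1) (H \<circ> G)"
    by (simp add: continuous_map_in_subtopology)
  have m_ball: "(H \<circ> G) z = ?k' (g z)" if "z \<in> ball 0 1" for z
  proof -
    have "g z \<in> D" using g(1) that by (auto simp: riemann_map_def)
    then have "G z = G' (?k' (g z))"
      using g(2) g'(2) that inv'(3,4) by (simp add: boundary_extension_def)
    moreover have "?k' (g z) \<in> cball 0 1" using inv'(3)[OF \<open>g z \<in> D\<close>] by simp
    ultimately show ?thesis using H(2) by simp
  qed
  have m\<sigma>: "(H \<circ> G) \<sigma> = \<sigma>'" using g(4) g'(3,4) H(2)[of \<sigma>'] by simp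
  have ev: "\<forall>\<^sub>F t in at_top. \<gamma> t \<in> D"
    using eventually_ge_at_top[of "0::real"] by eventually_elim (use \<gamma>(2) in auto)
  have "((\<lambda>t. (H \<circ> G) (?k (\<gamma> t))) \<longlongrightarrow> (H \<circ> G) \<sigma>) at_top"
  proof (rule continuous_on_tendsto_compose[OF m lim])
    show "\<sigma> \<in> cball 0 1" using g(3) by simp
    show "\<forall>\<^sub>F t in at_top. ?k (\<gamma> t) \<in> cball 0 1"
      using ev by eventually_elim (use inv(3) in fastforce)
  qed
  moreover have "\<forall>\<^sub>F t in at_top. (H \<circ> G) (?k (\<gamma> t)) = ?k' (\<gamma> t)"
    using ev by eventually_elim (use m_ball inv(3,4) in simp)
  ultimately have "((\<lambda>t. ?k' (\<gamma> t)) \<longlongrightarrow> \<sigma>') at_top"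
    unfolding m\<sigma> by (rule Lim_transform_eventually)
  with that[OF g'(1) _ _ lim'] show ?thesis using g'(3) by simp
qed

lemma landing_chart_at_infinity:
  fixes \<gamma> :: "real \<Rightarrow> complex"
  assumes g: "riemann_map D g" and \<sigma>: "cmod \<sigma> = 1" and \<gamma>: "\<gamma> ` {0..} \<subseteq> D"
    and lim: "((\<lambda>t. the_inv_into (ball 0 1) g (\<gamma> t)) \<longlongrightarrow> \<sigma>) at_top"
  shows "filterlim (\<lambda>t. cayley 1 (the_inv_into (ball 0 1) g (\<gamma> t) / \<sigma>)) at_infinity at_top"
proof -
  let ?u = "\<lambda>t. the_inv_into (ball 0 1) g (\<gamma> t) / \<sigma>"
  have "\<sigma> \<noteq> 0" using \<sigma> by auto
  then have u: "(?u \<longlongrightarrow> 1) at_top" using tendsto_divide[OF lim tendsto_const, of \<sigma>] by simp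
  have "filterlim (\<lambda>t. (1 + ?u t) * inverse (1 - ?u t)) at_infinity at_top"
  proof (rule tendsto_mult_filterlim_at_infinity)
    show "((\<lambda>t. 1 + ?u t) \<longlongrightarrow> 1 + 1) at_top" by (intro tendsto_intros u)
    have "((\<lambda>t. 1 - ?u t) \<longlongrightarrow> 1 - 1) at_top" by (intro tendsto_intros u)
    moreover have "\<forall>\<^sub>F t in at_top. 1 - ?u t \<noteq> 0"
    proof (rule eventually_mono[OF eventually_ge_at_top[of "0::real"]])
      fix t :: real assume "0 \<le> t"
      then have "the_inv_into (ball 0 1) g (\<gamma> t) \<in> ball 0 1"
        using riemann_map_inverse(3)[OF g] \<gamma> by auto
      then have "cmod (?u t) < 1" using \<sigma> by (simp add: norm_divide)
      then show "1 - ?u t \<noteq> 0" by auto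
    qed
    ultimately have "filterlim (\<lambda>t. 1 - ?u t) (at 0) at_top" by (simp add: filterlim_at)
    then show "filterlim (\<lambda>t. inverse (1 - ?u t)) at_infinity at_top"
      by (rule filterlim_compose[OF filterlim_inverse_at_infinity])
  qed simp
  then show ?thesis by (simp add: cayley_def divide_inverse)
qed

section \<open>Wedges at infinity and sectors\<close>

text \<open>
  The logarithm carries \<open>wedge M 0\<close> to a horizontal strip that is strictly narrower than the image of
  the whole half-plane. So a wedge is a hyperbolic neighbourhood of the positive real axis, and the
  bound \<open>a\<close> cuts off a tail of it.
\<close>

definition wedge :: "real \<Rightarrow> real \<Rightarrow> complex set" where
  "wedge M a = {w. a < Re w \<and> \<bar>Im w\<bar> < M * Re w}"

lemma wedge_rhp: "0 \<le> a \<Longrightarrow> wedge M a \<subseteq> rhp"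
  by (auto simp: wedge_def)

lemma wedge_mono: "M \<le> M' \<Longrightarrow> 0 \<le> a' \<Longrightarrow> a' \<le> a \<Longrightarrow> wedge M a \<subseteq> wedge M' a'"
  by (auto simp: wedge_def intro!: less_le_trans[OF _ mult_right_mono[of M M']])

text \<open>
  Inside a hyperbolic disc of fixed radius the real parts have bounded ratio. With
  \<open>C = 4 / (1 - r\<^sup>2)\<close> the formula \<open>one_minus_pseudo_dist\<close> turns \<open>pseudo_dist w0 w < r\<close> into
  \<open>\<bar>w + cnj w0\<bar>\<^sup>2 < C Re w Re w0\<close>, which bounds this ratio and also the difference of the imaginary parts
  relative to the real parts.
\<close>

lemma pseudo_disc_wedge:
  assumes r: "0 \<le> r" "r < 1" and M: "0 < M" and a: "0 \<le> a"
    and w0: "w0 \<in> wedge M (4 / (1 - r\<^sup>2) * a)" and w: "w \<in> rhp" and d: "pseudo_dist w0 w < r"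
  shows "w \<in> wedge (4 / (1 - r\<^sup>2) * (M + 1)) a"
proof -
  define q where "q = 1 - r\<^sup>2"
  define C where "C = 4 / q"
  have q: "0 < q" "q \<le> 1" using r by (auto simp: q_def abs_square_less_1)
  have C: "4 \<le> C" unfolding C_def using q by (simp add: field_simps)
  have w0': "C * a < Re w0" "\<bar>Im w0\<bar> < M * Re w0" using w0 by (auto simp: wedge_def C_def q_def)
  have w0r: "w0 \<in> rhp" using w0 wedge_rhp[of "4 / (1 - r\<^sup>2) * a" M] a q(1) by (auto simp: q_def)
  define x x0 where "x = Re w" and "x0 = Re w0"
  have pos: "0 < x" "0 < x0" using w w0r by (auto simp: x_def x0_def)
  have "(pseudo_dist w0 w)\<^sup>2 < r\<^sup>2" using d pseudo_dist_bounds(1)[OF w0r w] by (simp add: power_strict_mono)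
  then have "q < 4 * x0 * x / (cmod (w + cnj w0))\<^sup>2"
    using one_minus_pseudo_dist[OF w0r w] by (simp add: q_def x_def x0_def)
  then have "(cmod (w + cnj w0))\<^sup>2 < C * (x * x0)"
    using rhp_add_cnj_neq_0[OF w0r w] q by (simp add: C_def field_simps)
  then have main: "(x + x0)\<^sup>2 + (Im w - Im w0)\<^sup>2 < C * (x * x0)"
    unfolding cmod_power2 by (simp add: x_def x0_def)
  have "x0 * x0 \<le> (x + x0)\<^sup>2" using pos by (simp add: power2_eq_square algebra_simps)
  then have "x0 * x0 < C * (x * x0)" using main zero_le_power2[of "Im w - Im w0"] by linarith
  then have "x0 * x0 < (C * x) * x0" by (simp add: mult.assoc)
  then have x0: "x0 < C * x" using pos by simp
  have "(Im w - Im w0)\<^sup>2 < C * (x * x0)" using main zero_le_power2[of "x + x0"] by linarith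
  also have "\<dots> \<le> C * (x * (C * x))" using x0 pos C by (intro mult_left_mono) auto
  also have "\<dots> = (C * x)\<^sup>2" by (simp add: power2_eq_square)
  finally have "\<bar>Im w - Im w0\<bar> < C * x"
    using pos C by (metis abs_of_pos power2_less_imp_less abs_ge_zero mult_pos_pos power2_abs less_le_trans zero_less_numeral less_imp_le)
  moreover have "M * x0 \<le> M * (C * x)" using x0 M by simp
  ultimately have "\<bar>Im w\<bar> < C * (M + 1) * x" using w0'(2) by (simp add: x0_def algebra_simps)
  moreover have "C * a < C * x" using w0'(1) x0 by (simp add: x0_def)
  then have "a < x" using C by simp
  ultimately show ?thesis by (simp add: wedge_def C_def q_def x_def)
qed

context half_plane_chart
begin

lemma horizontal_ray_Re_at_top:
  assumes geo: "hyp_geodesic_on D {0..} \<gamma>"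
    and lim: "filterlim (\<lambda>t. k (\<gamma> t)) at_infinity at_top"
  shows "filterlim (\<lambda>t. Re (k (\<gamma> t))) at_top at_top"
proof -
  define c where "c = \<bar>Im (k (\<gamma> 0))\<bar>"
  have "filterlim (\<lambda>t. - c + cmod (k (\<gamma> t))) at_top at_top"
    using filterlim_tendsto_add_at_top[OF tendsto_const filterlim_at_infinity_imp_norm_at_top[OF lim]] .
  moreover have "\<forall>\<^sub>F t in at_top. - c + cmod (k (\<gamma> t)) \<le> Re (k (\<gamma> t))"
    using eventually_ge_at_top[of "0::real"]
  proof eventually_elim
    fix t :: real assume t: "0 \<le> t"
    then have "\<gamma> t \<in> D" using geo by (auto simp: hyp_geodesic_on_def)
    then have "0 < Re (k (\<gamma> t))" using k_rhp by blast
    then show "- c + cmod (k (\<gamma> t)) \<le> Re (k (\<gamma> t))"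
      using cmod_le[of "k (\<gamma> t)"] geodesic_ray_horizontal[OF geo lim t] by (simp add: c_def)
  qed
  ultimately show ?thesis by (rule filterlim_at_top_mono)
qed

text \<open>
  The ray is horizontal and its real part tends to infinity, so far out it has slope less than 1, and
  \<open>pseudo_disc_wedge\<close> applies to the discs around its points. The slope \<open>M\<close> depends on \<open>R\<close> only, and
  the wedge can be cut off at any \<open>a\<close>.
\<close>

lemma sector_subset_wedge:
  assumes geo: "hyp_geodesic_on D {0..} \<gamma>"
    and lim: "filterlim (\<lambda>t. k (\<gamma> t)) at_infinity at_top" and R: "0 < R"
  obtains M where "0 < M" "\<And>a. 0 \<le> a \<Longrightarrow> \<exists>t1\<ge>0. hyp_sector D \<gamma> t1 R \<subseteq> h ` wedge M a"
proof
  define r where "r = tanh R"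
  have r: "0 \<le> r" "r < 1" using R by (auto simp: r_def tanh_real_lt_1)
  define C where "C = 4 / (1 - r\<^sup>2)"
  have C: "0 < C" using r by (simp add: C_def abs_square_less_1)
  show "0 < C * (1 + 1)" using C by simp
  fix a :: real assume a: "0 \<le> a"
  have "\<forall>\<^sub>F t in at_top. max (C * a) \<bar>Im (k (\<gamma> 0))\<bar> < Re (k (\<gamma> t))"
    using horizontal_ray_Re_at_top[OF geo lim] by (simp add: filterlim_at_top_dense eventually_conj_iff)
  then obtain T where T: "\<And>t. T \<le> t \<Longrightarrow> max (C * a) \<bar>Im (k (\<gamma> 0))\<bar> < Re (k (\<gamma> t))"
    by (auto simp: eventually_at_top_linorder)
  have "hyp_sector D \<gamma> (max 0 T) R \<subseteq> h ` wedge (C * (1 + 1)) a"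
  proof
    fix z assume "z \<in> hyp_sector D \<gamma> (max 0 T) R"
    then have z: "z \<in> D" "(INF t\<in>{max 0 T..}. hyp_dist D z (\<gamma> t)) < R" by (auto simp: hyp_sector_def)
    then obtain t where t: "max 0 T \<le> t" "hyp_dist D z (\<gamma> t) < R"
      using cInf_lessD[of "(\<lambda>t. hyp_dist D z (\<gamma> t)) ` {max 0 T..}" R] by auto
    have \<gamma>t: "\<gamma> t \<in> D" using geo t by (auto simp: hyp_geodesic_on_def)
    have "artanh (pseudo_dist (k z) (k (\<gamma> t))) < R"
      using hyp_dist_h[OF k_rhp[OF z(1)] k_rhp[OF \<gamma>t]] t(2) h_k z(1) \<gamma>t by simp
    then have "pseudo_dist (k (\<gamma> t)) (k z) < r"
      using less_tanh_of_artanh_less pseudo_dist_bounds[OF k_rhp[OF \<gamma>t] k_rhp[OF z(1)]]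
      by (simp add: r_def pseudo_dist_commute)
    moreover have "k (\<gamma> t) \<in> wedge 1 (C * a)"
      using T[of t] t(1) geodesic_ray_horizontal[OF geo lim, of t] by (simp add: wedge_def)
    ultimately have "k z \<in> wedge (C * (1 + 1)) a"
      using pseudo_disc_wedge[OF r zero_less_one a _ k_rhp[OF z(1)]] by (simp add: C_def)
    then show "z \<in> h ` wedge (C * (1 + 1)) a" using h_k[OF z(1)] by (metis image_eqI)
  qed
  then show "\<exists>t1\<ge>0. hyp_sector D \<gamma> t1 R \<subseteq> h ` wedge (C * (1 + 1)) a"
    using max.cobounded1 by blast
qed

text \<open>
  A point of the wedge is compared with the point of the ray that has the same real part, which exists
  by the intermediate value theorem. Their distance is bounded in terms of the slope alone, so one
  sector contains a whole tail of the wedge. Together with \<open>sector_subset_wedge\<close> this makes internal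
  tangency independent of the chosen geodesic.
\<close>

lemma wedge_subset_of_sectors:
  assumes geo: "hyp_geodesic_on D {0..} \<gamma>"
    and lim: "filterlim (\<lambda>t. k (\<gamma> t)) at_infinity at_top"
    and sectors: "\<And>R. 0 < R \<Longrightarrow> \<exists>t0\<ge>0. hyp_sector D \<gamma> t0 R \<subseteq> D1" and M: "0 < M"
  obtains a where "0 < a" "h ` wedge M a \<subseteq> D1"
proof -
  define c where "c = Im (k (\<gamma> 0))"
  \<comment> \<open>If \<open>w = x + i y\<close> and \<open>\<bar>y - c\<bar> \<le> (M + 1) x\<close>, then \<open>q\<close> is a lower bound for
    \<open>1 - pseudo_dist (x + i c) w ^ 2\<close>.\<close>
  define q where "q = 4 / (4 + (M + 1)\<^sup>2)"
  have "0 < (M + 1)\<^sup>2" using M by simp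
  then have q: "0 < q" "q < 1" unfolding q_def by (simp_all add: divide_less_eq add_pos_pos)
  define R where "R = artanh (sqrt (1 - q)) + 1"
  have "artanh (0::real) < artanh (sqrt (1 - q))" by (rule artanh_less) (use q in auto)
  then have "0 < R" by (simp add: R_def)
  then obtain t0 where t0: "0 \<le> t0" "hyp_sector D \<gamma> t0 R \<subseteq> D1" using sectors by blast
  define a where "a = max (Re (k (\<gamma> t0))) (\<bar>c\<bar> + 1)"
  have \<gamma>D: "\<gamma> t \<in> D" if "0 \<le> t" for t using geo that by (auto simp: hyp_geodesic_on_def)
  have "h w \<in> D1" if w: "w \<in> wedge M a" for w
  proof -
    have a0: "0 \<le> a" by (simp add: a_def)
    then have wr: "w \<in> rhp" using w wedge_rhp[of a M] by blast
    obtain T where T: "\<And>t. T \<le> t \<Longrightarrow> Re w < Re (k (\<gamma> t))"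
      using horizontal_ray_Re_at_top[OF geo lim]
      by (auto simp: filterlim_at_top_dense eventually_at_top_linorder)
    define T' where "T' = max t0 T"
    have "continuous_on {0..T'} \<gamma>"
      using geo t0 by (auto simp: hyp_geodesic_on_def hyp_rectifiable_def piecewise_C1_differentiable_on_def T'_def)
    then have "continuous_on {t0..T'} \<gamma>" by (rule continuous_on_subset) (use t0 in auto)
    then have cont: "continuous_on {t0..T'} (\<lambda>t. Re (k (\<gamma> t)))"
      by (intro continuous_on_Re continuous_on_compose2[OF holomorphic_on_imp_continuous_on[OF hol_k]])
         (use \<gamma>D t0 in auto)
    have "Re (k (\<gamma> t0)) \<le> Re w" using w by (auto simp: wedge_def a_def)
    moreover have "Re w \<le> Re (k (\<gamma> T'))" using T[of T'] by (simp add: T'_def)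
    ultimately obtain t where t: "t0 \<le> t" "t \<le> T'" "Re (k (\<gamma> t)) = Re w"
      using IVT'[of "\<lambda>t. Re (k (\<gamma> t))" t0 "Re w" T'] cont by (auto simp: T'_def)
    define w0 where "w0 = k (\<gamma> t)"
    define x where "x = Re w"
    have t': "0 \<le> t" using t t0 by simp
    have w0: "w0 \<in> rhp" "Re w0 = x" "Im w0 = c"
      using k_rhp[OF \<gamma>D[OF t']] t(3) geodesic_ray_horizontal[OF geo lim t']
      by (simp_all add: w0_def c_def x_def)
    have x: "0 < x" "\<bar>c\<bar> \<le> x" "\<bar>Im w\<bar> < M * x" using w by (auto simp: wedge_def a_def x_def)
    have "\<bar>Im w - c\<bar> \<le> (M + 1) * x" using x by (simp add: algebra_simps)
    then have "(Im w - c)\<^sup>2 \<le> ((M + 1) * x)\<^sup>2" by (rule abs_le_square_iff[THEN iffD1, OF order_trans]) (use x M in simp)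
    then have "(cmod (w + cnj w0))\<^sup>2 \<le> (4 + (M + 1)\<^sup>2) * x\<^sup>2"
      unfolding cmod_power2 using w0(2,3)
      by (simp add: x_def[symmetric] power_mult_distrib power2_eq_square[of "x + x"] algebra_simps)
         (simp add: power2_eq_square algebra_simps)
    moreover have "0 < (cmod (w + cnj w0))\<^sup>2" using rhp_add_cnj_neq_0[OF w0(1) wr] by simp
    moreover have pM: "0 < 4 + (M + 1)\<^sup>2" by (simp add: add_pos_nonneg)
    ultimately have "q \<le> 4 * x * x / (cmod (w + cnj w0))\<^sup>2"
      using x by (simp add: q_def field_simps power2_eq_square)
    then have "(pseudo_dist w0 w)\<^sup>2 \<le> 1 - q"
      using one_minus_pseudo_dist[OF w0(1) wr] w0(2) by (simp add: x_def)
    then have "pseudo_dist w0 w \<le> sqrt (1 - q)" by (rule real_le_rsqrt)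
    then have "artanh (pseudo_dist w0 w) \<le> artanh (sqrt (1 - q))"
      using artanh_less[of "pseudo_dist w0 w" "sqrt (1 - q)"] pseudo_dist_bounds(1)[OF w0(1) wr] q
      by (cases "pseudo_dist w0 w = sqrt (1 - q)") auto
    then have dist: "hyp_dist D (h w) (\<gamma> t) < R"
      using hyp_dist_h[OF wr w0(1)] h_k[OF \<gamma>D[OF t']]
      by (simp add: R_def w0_def pseudo_dist_commute)
    have "(INF t\<in>{t0..}. hyp_dist D (h w) (\<gamma> t)) \<le> hyp_dist D (h w) (\<gamma> t)"
      by (rule cINF_lower) (use t t0 hyp_dist_nonneg h_D[OF wr] \<gamma>D in \<open>auto intro!: bdd_belowI[of _ 0]\<close>)
    then have "h w \<in> hyp_sector D \<gamma> t0 R"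
      using dist h_D[OF wr] by (simp add: hyp_sector_def)
    then show ?thesis using t0 by blast
  qed
  moreover have "0 < a" by (simp add: a_def)
  ultimately show ?thesis using that by blast
qed

end

section \<open>A smooth contraction onto a wedge\<close>

text \<open>
  The function is the identity up to \<open>b\<close> and equals \<open>b + c * s / (c + s)\<close> at \<open>b + s\<close> with
  \<open>s > 0\<close>; the second summand starts with slope 1 and increases to \<open>c\<close>. The truncation \<open>min y b\<close> would be
  simpler, but a piecewise C1 curve can cross the level \<open>b\<close> infinitely often, so the truncated curve
  need not be piecewise C1.
\<close>

lemma soft_cap:
  fixes b c :: real
  assumes c: "0 < c"
  obtains U U' where "\<And>y. (U has_real_derivative U' y) (at y)" "continuous_on UNIV U'"
    "\<And>y. \<bar>U' y\<bar> \<le> 1" "\<And>y. y \<le> b \<Longrightarrow> U y = y" "\<And>y. b \<le> y \<Longrightarrow> b \<le> U y"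
    "\<And>y. U y \<le> y" "\<And>y. U y < b + c"
proof
  define U where "U y = (if y \<in> {..b} then y else b + c * (y - b) / (c + (y - b)))" for y
  define U' where "U' y = (if y \<in> {..b} then 1 else (c / (c + (y - b)))\<^sup>2)" for y
  have closures: "closure {..b} \<inter> closure {b<..} = {b}" by auto
  have "(U has_vector_derivative U' y) (at y within UNIV)" for y
    unfolding U_def U'_def
  proof (rule has_vector_derivative_If_within_closures)
    show "((\<lambda>y. b + c * (y - b) / (c + (y - b))) has_vector_derivative (c / (c + (y - b)))\<^sup>2)
        (at y within {b<..} \<union> (closure {..b} \<inter> closure {b<..}))"
      if "y \<in> {b<..} \<union> (closure {..b} \<inter> closure {b<..})"
    proof -
      have "c + (y - b) \<noteq> 0" using that c unfolding closures by auto
      then show ?thesis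
        unfolding has_real_derivative_iff_has_vector_derivative[symmetric]
        by (auto intro!: derivative_eq_intros simp: power_divide power2_eq_square algebra_simps)
    qed
  qed (use c in auto)
  then show "(U has_real_derivative U' y) (at y)" for y
    by (simp add: has_real_derivative_iff_has_vector_derivative)
  have "continuous_on ({..b} \<union> {b..}) U'"
    unfolding U'_def
  proof (rule continuous_on_If)
    show "continuous_on {b..} (\<lambda>y. (c / (c + (y - b)))\<^sup>2)"
      using c by (intro continuous_intros) auto
  qed (use c in auto)
  moreover have "{..b} \<union> {b..} = UNIV" by auto
  ultimately show "continuous_on UNIV U'" by simp
  show "\<bar>U' y\<bar> \<le> 1" for y
    using c by (auto simp: U'_def abs_square_le_1)
  show "U y = y" if "y \<le> b" for y using that by (simp add: U_def)
  show "b \<le> U y" if "b \<le> y" for y using that c by (auto simp: U_def)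
  have frac: "c * s / (c + s) \<le> s" "c * s / (c + s) < c" if "0 < s" for s
    using that c by (auto simp: field_simps)
  show "U y \<le> y" for y
    using frac(1)[of "y - b"] by (auto simp: U_def)
  show "U y < b + c" for y
    using frac(2)[of "y - b"] c by (auto simp: U_def)
qed

lemma soft_clamp_below:
  fixes b c :: real
  assumes "0 < c"
  obtains \<psi> \<psi>' where "\<And>x. (\<psi> has_real_derivative \<psi>' x) (at x)" "continuous_on UNIV \<psi>'"
    "\<And>x. \<bar>\<psi>' x\<bar> \<le> 1" "\<And>x. b \<le> x \<Longrightarrow> \<psi> x = x" "\<And>x. b - c < \<psi> x"
proof -
  obtain U U' where U: "\<And>y. (U has_real_derivative U' y) (at y)" "continuous_on UNIV U'"
    "\<And>y. \<bar>U' y\<bar> \<le> 1" "\<And>y. y \<le> - b \<Longrightarrow> U y = y" "\<And>y. U y < - b + c"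
    by (rule soft_cap[OF assms, of "- b"]) blast
  show ?thesis
  proof (rule that[of "\<lambda>x. - U (- x)" "\<lambda>x. U' (- x)"])
    show "((\<lambda>x. - U (- x)) has_real_derivative U' (- x)) (at x)" for x
      using DERIV_minus[OF DERIV_chain2[OF U(1) DERIV_minus[OF DERIV_ident]], of x] by simp
    show "continuous_on UNIV (\<lambda>x. U' (- x))"
      by (rule continuous_on_compose2[OF U(2)]) (auto intro: continuous_intros)
    show "b - c < - U (- x)" for x using U(5)[of "- x"] by simp
  qed (use U in auto)
qed

text \<open>
  Two reflected copies of the cap, one for each sign.
\<close>

lemma soft_clamp_abs:
  fixes b c :: real
  assumes "0 < c" "0 < b"
  obtains \<phi> \<phi>' where "\<And>x. (\<phi> has_real_derivative \<phi>' x) (at x)" "continuous_on UNIV \<phi>'"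
    "\<And>x. \<bar>\<phi>' x\<bar> \<le> 1" "\<And>x. \<bar>x\<bar> \<le> b \<Longrightarrow> \<phi> x = x" "\<And>x. \<bar>\<phi> x\<bar> \<le> \<bar>x\<bar>" "\<And>x. \<bar>\<phi> x\<bar> < b + c"
proof -
  obtain U U' where U: "\<And>y. (U has_real_derivative U' y) (at y)" "continuous_on UNIV U'"
    "\<And>y. \<bar>U' y\<bar> \<le> 1" "\<And>y. y \<le> b \<Longrightarrow> U y = y" "\<And>y. b \<le> y \<Longrightarrow> b \<le> U y" "\<And>y. U y \<le> y" "\<And>y. U y < b + c"
    by (rule soft_cap[OF assms(1), of b]) blast
  have \<phi>: "- U (- U x) = (if x < - b then - U (- x) else U x)" for x
    using U(4)[of x] U(4)[of "- x"] U(4)[of "- U x"] U(5)[of x] assms by (cases "x \<le> b") auto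
  show ?thesis
  proof (rule that[of "\<lambda>x. - U (- U x)" "\<lambda>x. U' (- U x) * U' x"])
    show "((\<lambda>x. - U (- U x)) has_real_derivative U' (- U x) * U' x) (at x)" for x
      using DERIV_minus[OF DERIV_chain2[OF U(1) DERIV_minus[OF U(1)]], of x] by simp
    have "continuous_on UNIV U" by (rule DERIV_continuous_on[OF U(1)])
    then show "continuous_on UNIV (\<lambda>x. U' (- U x) * U' x)"
      by (intro continuous_on_mult U(2) continuous_on_compose2[OF U(2)]) (auto intro: continuous_intros)
    show "\<bar>U' (- U x) * U' x\<bar> \<le> 1" for x
      unfolding abs_mult using U(3)[of "- U x"] U(3)[of x] by (simp add: mult_le_one)
    show "- U (- U x) = x" if "\<bar>x\<bar> \<le> b" for x using that U(4)[of x] U(4)[of "- x"] by auto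
    show "\<bar>- U (- U x)\<bar> \<le> \<bar>x\<bar>" "\<bar>- U (- U x)\<bar> < b + c" for x
      unfolding \<phi> using U(4)[of x] U(5)[of x] U(5)[of "- x"] U(6,7)[of x] U(6,7)[of "- x"] assms
      by (cases "x \<le> b"; auto)+
  qed
qed

lemma Ln_rhp:
  assumes "w \<in> rhp"
  shows "exp (Ln w) = w" "\<bar>Im (Ln w)\<bar> < pi / 2" "Re w = cmod w * cos (Im (Ln w))"
    "Im (Ln w) = arctan (Im w / Re w)" "w \<notin> \<real>\<^sub>\<le>\<^sub>0"
proof -
  have w0: "w \<noteq> 0" using assms by auto
  then show e: "exp (Ln w) = w" by simp
  show im: "\<bar>Im (Ln w)\<bar> < pi / 2" using Re_Ln_pos_lt[OF w0] assms by simp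
  have n: "cmod w = exp (Re (Ln w))" by (metis e norm_exp_eq_Re)
  show re: "Re w = cmod w * cos (Im (Ln w))" unfolding n by (metis e Re_exp)
  have "Im w = cmod w * sin (Im (Ln w))" unfolding n by (metis e Im_exp)
  then have "Im w / Re w = tan (Im (Ln w))" using re w0 by (simp add: tan_def)
  then show "Im (Ln w) = arctan (Im w / Re w)" using im by (simp add: arctan_tan)
  show "w \<notin> \<real>\<^sub>\<le>\<^sub>0" using assms by (auto simp: complex_nonpos_Reals_iff)
qed

lemma wedge_Ln:
  assumes w: "w \<in> wedge M a" and a: "0 < a"
  shows "ln a \<le> Re (Ln w)" "\<bar>Im (Ln w)\<bar> \<le> arctan M"
proof -
  have wr: "w \<in> rhp" using w wedge_rhp[of a M] a by auto
  have "a \<le> cmod w" using w complex_Re_le_cmod[of w] by (auto simp: wedge_def)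
  then have "ln a \<le> ln (cmod w)" using a by (subst ln_le_cancel_iff) auto
  moreover have "w \<noteq> 0" using wr by auto
  ultimately show "ln a \<le> Re (Ln w)" by simp
  have "\<bar>Im w / Re w\<bar> \<le> M" using w wr by (auto simp: wedge_def abs_divide divide_simps)
  then have "arctan (Im w / Re w) \<le> arctan M" "arctan (- M) \<le> arctan (Im w / Re w)"
    unfolding arctan_le_iff by linarith+
  then show "\<bar>Im (Ln w)\<bar> \<le> arctan M" unfolding Ln_rhp(4)[OF wr] by (simp add: arctan_minus)
qed

lemma exp_wedge:
  assumes "ln a - 1 < Re z" "\<bar>Im z\<bar> < \<theta>" "0 < a" "\<theta> < pi / 2"
  shows "exp z \<in> wedge (tan \<theta>) (a * (cos \<theta> * exp (- 1)))"
proof -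
  have \<theta>: "0 < \<theta>" using assms by simp
  have "cos \<theta> < cos \<bar>Im z\<bar>" using assms by (intro cos_monotone_0_pi) auto
  then have c: "cos \<theta> < cos (Im z)" by simp
  have c0: "0 < cos \<theta>" using \<theta> assms by (intro cos_gt_zero_pi) auto
  have "a * exp (- 1) = exp (ln a - 1)" using exp_add[of "ln a" "- 1"] assms by simp
  also have "\<dots> < exp (Re z)" using assms by simp
  finally have "a * exp (- 1) * cos \<theta> < exp (Re z) * cos (Im z)"
    using c c0 assms by (intro mult_strict_mono) auto
  moreover have "tan (Im z) < tan \<theta>" "tan (- Im z) < tan \<theta>"
    by (rule tan_monotone; use assms in linarith)+
  then have "\<bar>tan (Im z)\<bar> < tan \<theta>" by simp
  then have "\<bar>sin (Im z)\<bar> < tan \<theta> * cos (Im z)"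
    using c c0 by (simp add: tan_def abs_divide divide_simps split: if_splits)
  then have "exp (Re z) * \<bar>sin (Im z)\<bar> < tan \<theta> * (exp (Re z) * cos (Im z))"
    by (simp add: mult.left_commute)
  ultimately show ?thesis
    by (simp add: wedge_def Re_exp Im_exp abs_mult mult.assoc mult.commute[of "cos \<theta>"])
qed

lemma C1_map_Re_Im:
  assumes f: "f piecewise_C1_differentiable_on I"
    and \<psi>: "\<And>x. (\<psi> has_real_derivative \<psi>' x) (at x)" "continuous_on UNIV \<psi>'"
    and \<phi>: "\<And>x. (\<phi> has_real_derivative \<phi>' x) (at x)" "continuous_on UNIV \<phi>'"
  defines "F \<equiv> \<lambda>t. Complex (\<psi> (Re (f t))) (\<phi> (Im (f t)))"
  shows "F piecewise_C1_differentiable_on I"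
    and "(f has_vector_derivative v) (at t) \<Longrightarrow>
      (F has_vector_derivative Complex (\<psi>' (Re (f t)) * Re v) (\<phi>' (Im (f t)) * Im v)) (at t)"
proof -
  have F: "F = (\<lambda>t. of_real (\<psi> (Re (f t))) + \<i> * of_real (\<phi> (Im (f t))))"
    by (simp add: F_def complex_eq_iff fun_eq_iff)
  show der: "(F has_vector_derivative Complex (\<psi>' (Re (f t)) * Re v) (\<phi>' (Im (f t)) * Im v)) (at t)"
    if v: "(f has_vector_derivative v) (at t)" for t v
  proof -
    have "((\<lambda>t. Re (f t)) has_real_derivative Re v) (at t)" "((\<lambda>t. Im (f t)) has_real_derivative Im v) (at t)"
      unfolding has_real_derivative_iff_has_vector_derivative
      using bounded_linear.has_vector_derivative[OF bounded_linear_Re v]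
        bounded_linear.has_vector_derivative[OF bounded_linear_Im v] by auto
    from DERIV_chain2[OF \<psi>(1) this(1)] DERIV_chain2[OF \<phi>(1) this(2)]
    show ?thesis
      by (simp add: has_vector_derivative_complex_iff has_real_derivative_iff_has_vector_derivative F_def)
  qed
  obtain S where S: "finite S" "\<And>t. t \<in> I - S \<Longrightarrow> f differentiable (at t)"
    "continuous_on (I - S) (\<lambda>t. vector_derivative f (at t))" and contf: "continuous_on I f"
    using f unfolding piecewise_C1_differentiable_on_def C1_differentiable_on_eq by blast
  have "continuous_on UNIV \<psi>" "continuous_on UNIV \<phi>"
    using DERIV_continuous_on[OF \<psi>(1)] DERIV_continuous_on[OF \<phi>(1)] by auto
  then have "continuous_on I (\<lambda>t. \<psi> (Re (f t)))" "continuous_on I (\<lambda>t. \<phi> (Im (f t)))"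
    using contf by (auto intro: continuous_on_compose2 continuous_on_Re continuous_on_Im)
  then have "continuous_on I F"
    unfolding F by (intro continuous_intros)
  moreover have "F C1_differentiable_on (I - S)"
    unfolding C1_differentiable_on_def
  proof (intro exI conjI ballI)
    fix t assume "t \<in> I - S"
    then have "(f has_vector_derivative vector_derivative f (at t)) (at t)"
      using S(2) by (simp add: vector_derivative_works)
    from der[OF this] show "(F has_vector_derivative Complex (\<psi>' (Re (f t)) * Re (vector_derivative f (at t)))
       (\<phi>' (Im (f t)) * Im (vector_derivative f (at t)))) (at t)" .
  next
    have "continuous_on (I - S) f" using contf by (rule continuous_on_subset) auto
    then have "continuous_on (I - S) (\<lambda>t. \<psi>' (Re (f t)))" "continuous_on (I - S) (\<lambda>t. \<phi>' (Im (f t)))"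
      using \<psi>(2) \<phi>(2) by (auto intro: continuous_on_compose2 continuous_on_Re continuous_on_Im)
    then show "continuous_on (I - S) (\<lambda>t. Complex (\<psi>' (Re (f t)) * Re (vector_derivative f (at t)))
       (\<phi>' (Im (f t)) * Im (vector_derivative f (at t))))"
      unfolding Complex_eq by (intro continuous_intros S(3))
  qed
  ultimately show "F piecewise_C1_differentiable_on I"
    using S(1) unfolding piecewise_C1_differentiable_on_def by blast
qed

context half_plane_chart
begin

text \<open>
  In the coordinate \<open>Ln w = \<xi> + i \<eta>\<close> the half-plane is the strip \<open>\<bar>\<eta>\<bar> < \<pi> / 2\<close> with density
  \<open>1 / (2 cos \<eta>)\<close>, which does not depend on \<open>\<xi>\<close> and increases with \<open>\<bar>\<eta>\<bar>\<close>. So a map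
  \<open>(\<xi>, \<eta>) \<mapsto> (\<psi> \<xi>, \<phi> \<eta>)\<close> with \<open>\<bar>\<psi>'\<bar> \<le> 1\<close>, \<open>\<bar>\<phi>'\<bar> \<le> 1\<close> and \<open>\<bar>\<phi> \<eta>\<bar> \<le> \<bar>\<eta>\<bar>\<close> does not increase
  hyperbolic length. Soft clamps of this kind fix the given wedge and push every curve into a
  slightly larger one. This has the effect of hyperbolic convexity of wedges, but acts on curves instead of
  geodesics, as the definition of the distance by an infimum requires.
\<close>

lemma retract_path_to_wedge:
  assumes M: "0 < M"
  obtains M' \<delta> where "0 < M'" "0 < \<delta>" "\<delta> \<le> 1"
    "\<And>a p. 0 < a \<Longrightarrow> hyp_rectifiable D p 0 1 \<Longrightarrow> p 0 \<in> h ` wedge M a \<Longrightarrow> p 1 \<in> h ` wedge M a \<Longrightarrow>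
      \<exists>q S. q piecewise_C1_differentiable_on {0..1} \<and> q ` {0..1} \<subseteq> h ` wedge M' (a * \<delta>) \<and>
        q 0 = p 0 \<and> q 1 = p 1 \<and> finite S \<and> (\<forall>t\<in>{0..1} - S. hyp_speed D q t \<le> hyp_speed D p t)"
proof -
  define \<theta> where "\<theta> = arctan M"
  have \<theta>: "0 < \<theta>" "\<theta> < pi / 2" using M arctan_ubound[of M] by (auto simp: \<theta>_def)
  \<comment> \<open>The larger wedge has opening angle \<open>\<theta> + c\<close>, half-way between that of the given wedge and that of
    the half-plane.\<close>
  define c where "c = (pi / 2 - \<theta>) / 2"
  have c: "0 < c" "\<theta> + c < pi / 2" using \<theta> by (auto simp: c_def field_simps)
  obtain \<phi> \<phi>' where \<phi>: "\<And>x. (\<phi> has_real_derivative \<phi>' x) (at x)" "continuous_on UNIV \<phi>'"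
    "\<And>x. \<bar>\<phi>' x\<bar> \<le> 1" "\<And>x. \<bar>x\<bar> \<le> \<theta> \<Longrightarrow> \<phi> x = x" "\<And>x. \<bar>\<phi> x\<bar> \<le> \<bar>x\<bar>" "\<And>x. \<bar>\<phi> x\<bar> < \<theta> + c"
    by (rule soft_clamp_abs[OF c(1) \<theta>(1)]) blast
  show ?thesis
  proof (rule that[of "tan (\<theta> + c)" "cos (\<theta> + c) * exp (- 1)"])
    show "0 < tan (\<theta> + c)" using \<theta> c by (intro tan_gt_zero) auto
    show "0 < cos (\<theta> + c) * exp (- 1)" using \<theta> c by (simp add: cos_gt_zero_pi)
    have "cos (\<theta> + c) * exp (- 1) \<le> 1 * 1" using \<theta> c by (intro mult_mono) auto
    then show "cos (\<theta> + c) * exp (- 1) \<le> 1" by simp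
    fix a :: real and p
    assume a: "0 < a" and p: "hyp_rectifiable D p 0 1" and ends: "p 0 \<in> h ` wedge M a" "p 1 \<in> h ` wedge M a"
    obtain \<psi> \<psi>' where \<psi>: "\<And>x. (\<psi> has_real_derivative \<psi>' x) (at x)" "continuous_on UNIV \<psi>'"
      "\<And>x. \<bar>\<psi>' x\<bar> \<le> 1" "\<And>x. ln a \<le> x \<Longrightarrow> \<psi> x = x" "\<And>x. ln a - 1 < \<psi> x"
      by (rule soft_clamp_below[OF zero_less_one, of "ln a"]) blast
    have pD: "p t \<in> D" if "t \<in> {0..1}" for t using p that by (auto simp: hyp_rectifiable_def)
    have pC1: "p piecewise_C1_differentiable_on {0..1}" using p by (simp add: hyp_rectifiable_def)
    then obtain S where S: "finite S" "\<And>t. t \<in> {0..1} - S \<Longrightarrow> p differentiable (at t)"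
      unfolding piecewise_C1_differentiable_on_def C1_differentiable_on_eq by blast
    define \<zeta> where "\<zeta> = (Ln \<circ> k) \<circ> p"
    define Z where "Z = (\<lambda>t. Complex (\<psi> (Re (\<zeta> t))) (\<phi> (Im (\<zeta> t))))"
    define q where "q = h \<circ> (exp \<circ> Z)"
    have "Ln holomorphic_on rhp"
      using Ln_rhp(5) by (intro holomorphic_on_Ln) auto
    then have "Ln \<circ> k holomorphic_on D"
      by (rule holomorphic_on_compose_gen[OF hol_k]) (use k_rhp in auto)
    then have \<zeta>C1: "\<zeta> piecewise_C1_differentiable_on {0..1}"
      unfolding \<zeta>_def by (intro piecewise_C1_holomorphic_compose[OF pC1 _ open_D]) (use pD in auto)
    note Z = C1_map_Re_Im[OF \<zeta>C1 \<psi>(1,2) \<phi>(1,2), folded Z_def]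
    have wedge: "exp (Z t) \<in> wedge (tan (\<theta> + c)) (a * (cos (\<theta> + c) * exp (- 1)))" for t
      by (rule exp_wedge) (use \<psi>(5) \<phi>(6) a c in \<open>auto simp: Z_def\<close>)
    have rhp: "exp (Z t) \<in> rhp" for t
      using wedge[of t] wedge_rhp[of "a * (cos (\<theta> + c) * exp (- 1))"] a \<open>0 < cos (\<theta> + c) * exp (- 1)\<close> by fastforce
    have "(exp \<circ> Z) piecewise_C1_differentiable_on {0..1}"
      by (rule piecewise_C1_holomorphic_compose[OF Z(1) _ open_UNIV]) (auto intro: holomorphic_intros)
    then have qC1: "q piecewise_C1_differentiable_on {0..1}"
      unfolding q_def by (rule piecewise_C1_holomorphic_compose[OF _ _ open_rhp hol_h]) (use rhp in auto)
    have q_eq: "q t = p t" if pt: "p t \<in> h ` wedge M a" for t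
    proof -
      obtain w where w: "w \<in> wedge M a" "p t = h w" using pt by blast
      have wr: "w \<in> rhp" using w(1) wedge_rhp[of a M] a by auto
      have "\<zeta> t = Ln w" using k_h[OF wr] w(2) by (simp add: \<zeta>_def)
      then have "Z t = Ln w"
        using wedge_Ln[OF w(1) a] \<psi>(4) \<phi>(4) by (simp add: Z_def \<theta>_def)
      then show ?thesis using Ln_rhp(1)[OF wr] w(2) by (simp add: q_def)
    qed
    have speed: "hyp_speed D q t \<le> hyp_speed D p t" if t: "t \<in> {0..1} - S" for t
    proof -
      have pt: "p t \<in> D" using pD t by auto
      define w where "w = k (p t)"
      have wr: "w \<in> rhp" unfolding w_def by (rule k_rhp[OF pt])
      define p' where "p' = vector_derivative p (at t)"
      have p': "(p has_vector_derivative p') (at t)"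
        using S(2)[OF t] by (simp add: p'_def vector_derivative_works)
      define v where "v = p' * deriv k (p t)"
      have "((Ln \<circ> (k \<circ> p)) has_vector_derivative v * inverse w) (at t)"
        by (rule field_vector_diff_chain_at[OF has_vector_derivative_k[OF p' pt, folded v_def]])
           (use has_field_derivative_Ln[OF Ln_rhp(5)[OF wr]] in \<open>simp add: w_def\<close>)
      then have \<zeta>': "(\<zeta> has_vector_derivative v / w) (at t)"
        by (simp add: \<zeta>_def o_assoc divide_inverse)
      define Z' where "Z' = Complex (\<psi>' (Re (\<zeta> t)) * Re (v / w)) (\<phi>' (Im (\<zeta> t)) * Im (v / w))"
      have dZ: "(Z has_vector_derivative Z') (at t)" unfolding Z'_def by (rule Z(2)[OF \<zeta>'])
      have "((exp \<circ> Z) has_vector_derivative Z' * exp (Z t)) (at t)"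
        by (rule field_vector_diff_chain_at[OF dZ DERIV_exp])
      from hyp_speed_h[OF this] rhp[of t]
      have "hyp_speed D q t = cmod Z' / (2 * cos (\<phi> (Im (\<zeta> t))))"
        by (simp add: q_def norm_mult norm_exp_eq_Re Re_exp Z_def)
      moreover have \<zeta>t: "Im (\<zeta> t) = Im (Ln w)" by (simp add: \<zeta>_def w_def)
      moreover have "hyp_speed D p t = cmod (v / w) / (2 * cos (Im (Ln w)))"
        using hyp_speed_k[OF p' pt, folded v_def w_def] Ln_rhp(3)[OF wr] by (simp add: norm_divide)
      moreover have "cmod Z' \<le> cmod (v / w)"
        unfolding cmod_def Z'_def using \<psi>(3) \<phi>(3)
        by (intro real_sqrt_le_mono add_mono)
           (auto simp: power_mult_distrib abs_square_le_1 intro!: mult_left_le_one_le)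
      moreover have "cos (Im (Ln w)) \<le> cos (\<phi> (Im (Ln w)))"
      proof -
        have "cos \<bar>Im (Ln w)\<bar> \<le> cos \<bar>\<phi> (Im (Ln w))\<bar>"
          using \<phi>(5)[of "Im (Ln w)"] Ln_rhp(2)[OF wr] by (intro cos_monotone_0_pi_le) auto
        then show ?thesis by simp
      qed
      moreover have "0 < cos (Im (Ln w))" using Ln_rhp(2)[OF wr] by (intro cos_gt_zero_pi) auto
      ultimately show ?thesis by (simp add: frac_le)
    qed
    show "\<exists>q S. q piecewise_C1_differentiable_on {0..1} \<and>
        q ` {0..1} \<subseteq> h ` wedge (tan (\<theta> + c)) (a * (cos (\<theta> + c) * exp (- 1))) \<and>
        q 0 = p 0 \<and> q 1 = p 1 \<and> finite S \<and> (\<forall>t\<in>{0..1} - S. hyp_speed D q t \<le> hyp_speed D p t)"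
      using qC1 q_eq ends S(1) speed wedge by (intro exI[of _ q] exI[of _ S]) (auto simp: q_def)
  qed
qed

end

section \<open>Comparison of a domain with a subdomain\<close>

text \<open>
  Precomposing the chart with \<open>cayley (k z)\<close> moves \<open>z\<close> to the centre of the disc, where the density is
  the reciprocal of the derivative and \<open>schwarz_inclusion\<close> applies.
\<close>

lemma hyp_density_comparison:
  assumes D: "half_plane_chart D h k" and D1: "half_plane_chart D1 h1 k1"
    and z: "z \<in> D" "z \<in> D1" and r: "0 < r" "r \<le> 1"
    and disc: "(h \<circ> cayley (k z)) ` ball 0 r \<subseteq> D1"
  shows "r * hyp_density D1 z \<le> hyp_density D z"
proof -
  interpret D: half_plane_chart D h k by (rule D)
  interpret D1: half_plane_chart D1 h1 k1 by (rule D1)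
  have density: "hyp_density D z = 1 / cmod (deriv (h \<circ> cayley (k z)) 0)"
    using D.hyp_density_chart[OF D.k_rhp[OF z(1)]] D.deriv_h_cayley[OF D.k_rhp[OF z(1)]]
      D.h_k[OF z(1)] D.k_rhp[OF z(1)] by (simp add: norm_mult mult.commute)
  have density1: "hyp_density D1 z = 1 / cmod (deriv (h1 \<circ> cayley (k1 z)) 0)"
    using D1.hyp_density_chart[OF D1.k_rhp[OF z(2)]] D1.deriv_h_cayley[OF D1.k_rhp[OF z(2)]]
      D1.h_k[OF z(2)] D1.k_rhp[OF z(2)] by (simp add: norm_mult mult.commute)
  have "(h \<circ> cayley (k z)) holomorphic_on ball 0 1"
    using D.riemann_map_cayley[OF D.k_rhp[OF z(1)]] by (simp add: riemann_map_def)
  then have "(h \<circ> cayley (k z)) holomorphic_on ball 0 r"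
    by (rule holomorphic_on_subset) (use r in auto)
  then have "r * cmod (deriv (h \<circ> cayley (k z)) 0) \<le> cmod (deriv (h1 \<circ> cayley (k1 z)) 0)"
    by (rule schwarz_inclusion[OF _ r(1) disc D1.riemann_map_cayley[OF D1.k_rhp[OF z(2)]]])
       (use D.cayley_at_0 D1.cayley_at_0 D.h_k D1.h_k z in simp)
  moreover have "0 < hyp_density D z" "0 < hyp_density D1 z"
    using D.hyp_density_pos D1.hyp_density_pos z by auto
  ultimately show ?thesis unfolding density density1
    by (simp add: divide_simps split: if_splits)
qed

lemma hyp_density_antimono:
  assumes D: "half_plane_chart D h k" and D1: "half_plane_chart D1 h1 k1"
    and "D1 \<subseteq> D" "z \<in> D1"
  shows "hyp_density D z \<le> hyp_density D1 z"
proof -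
  have "(h1 \<circ> cayley (k1 z)) ` ball 0 1 \<subseteq> D"
    using half_plane_chart.riemann_map_cayley[OF D1 half_plane_chart.k_rhp[OF D1 assms(4)]] assms(3)
    by (simp add: riemann_map_def)
  from hyp_density_comparison[OF D1 D _ _ zero_less_one order_refl this] assms(3,4) show ?thesis by auto
qed

lemma hyp_dist_antimono:
  assumes D: "half_plane_chart D h k" and D1: "half_plane_chart D1 h1 k1"
    and "D1 \<subseteq> D" "z \<in> D1" "w \<in> D1"
  shows "hyp_dist D z w \<le> hyp_dist D1 z w"
proof -
  interpret D: half_plane_chart D h k by (rule D)
  interpret D1: half_plane_chart D1 h1 k1 by (rule D1)
  obtain p0 where p0: "hyp_rectifiable D1 p0 0 1" "p0 0 = z" "p0 1 = w"
    by (rule D1.rectifiable_path_exists[OF assms(4,5)])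
  show ?thesis
    unfolding hyp_dist_def[of D1]
  proof (rule cInf_greatest)
    show "{hyp_length D1 p 0 1 |p. hyp_rectifiable D1 p 0 1 \<and> p 0 = z \<and> p 1 = w} \<noteq> {}"
      using p0 by blast
    fix l assume "l \<in> {hyp_length D1 p 0 1 |p. hyp_rectifiable D1 p 0 1 \<and> p 0 = z \<and> p 1 = w}"
    then obtain p where p: "l = hyp_length D1 p 0 1" "hyp_rectifiable D1 p 0 1" "p 0 = z" "p 1 = w"
      by blast
    have rect: "p ` {0..1} \<subseteq> D1" "p piecewise_C1_differentiable_on {0..1}" "hyp_speed D1 p integrable_on {0..1}"
      using p(2) by (auto simp: hyp_rectifiable_def)
    have le: "hyp_speed D p t \<le> hyp_speed D1 p t" if "t \<in> {0..1} - {}" for t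
    proof -
      have "p t \<in> D1" using rect(1) that by auto
      then show ?thesis
        unfolding hyp_speed_def
        using hyp_density_antimono[OF D D1 assms(3)] by (intro mult_right_mono) auto
    qed
    note maj = D.hyp_rectifiable_majorant[OF subset_trans[OF rect(1) assms(3)] rect(2,3) finite.emptyI le]
    show "hyp_dist D z w \<le> l"
      using D.hyp_dist_le_length[OF maj(1) p(3,4)] maj(2) p(1) by (simp add: hyp_length_def)
  qed
qed

lemma sc_domain_chart:
  assumes "sc_domain D" "D \<noteq> UNIV"
  obtains h k where "half_plane_chart D h k"
proof -
  have "(\<exists>f g. f holomorphic_on D \<and> g holomorphic_on ball 0 1 \<and>
      (\<forall>z\<in>D. f z \<in> ball 0 1 \<and> g (f z) = z) \<and> (\<forall>z\<in>ball 0 1. g z \<in> D \<and> f (g z) = z))"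
    using Riemann_mapping_theorem[of D] assms unfolding sc_domain_def by blast
  then obtain f g where fg: "g holomorphic_on ball 0 1"
    "\<And>z. z \<in> D \<Longrightarrow> f z \<in> ball 0 1" "\<And>z. z \<in> D \<Longrightarrow> g (f z) = z"
    "\<And>z. z \<in> ball 0 1 \<Longrightarrow> g z \<in> D" "\<And>z. z \<in> ball 0 1 \<Longrightarrow> f (g z) = z"
    by blast
  have "inj_on g (ball 0 1)" by (rule inj_on_inverseI[of _ f]) (rule fg(5))
  moreover have "g ` ball 0 1 = D"
  proof
    show "g ` ball 0 1 \<subseteq> D" using fg(4) by blast
    show "D \<subseteq> g ` ball 0 1"
    proof
      fix z assume "z \<in> D"
      then show "z \<in> g ` ball 0 1" using fg(2,3) by (intro image_eqI[of _ _ "f z"]) simp_all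
    qed
  qed
  ultimately have "riemann_map D g" using fg(1) by (simp add: riemann_map_def)
  from half_plane_chart_of_riemann_map[OF this norm_one] show ?thesis by (rule that)
qed

text \<open>
  The pseudohyperbolic disc of radius \<open>1 / K\<close> around \<open>w\<close> stays in the larger wedge by
  \<open>pseudo_disc_wedge\<close>, hence in \<open>D1\<close>, and \<open>hyp_density_comparison\<close> gives the factor \<open>K\<close>.
\<close>

lemma wedge_comparison:
  assumes D: "half_plane_chart D h k" and D1: "half_plane_chart D1 h1 k1" and M: "0 < M" "0 \<le> a" "1 < K"
    and sub: "h ` wedge (4 / (1 - (1 / K)\<^sup>2) * (M + 1)) a \<subseteq> D1"
    and w: "w \<in> wedge M (4 / (1 - (1 / K)\<^sup>2) * a)" and wD1: "h w \<in> D1"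
  shows "hyp_density D1 (h w) \<le> K * hyp_density D (h w)"
proof -
  interpret D: half_plane_chart D h k by (rule D)
  define r where "r = 1 / K"
  have r: "0 < r" "r < 1" using M by (auto simp: r_def)
  have "0 \<le> 4 / (1 - r\<^sup>2) * a" using r M by (simp add: abs_square_le_1)
  then have wr: "w \<in> rhp" using w wedge_rhp[of "4 / (1 - r\<^sup>2) * a" M] by (auto simp: r_def)
  have "(h \<circ> cayley (k (h w))) ` ball 0 r \<subseteq> D1"
  proof
    fix y assume "y \<in> (h \<circ> cayley (k (h w))) ` ball 0 r"
    then obtain u where u: "u \<in> ball 0 r" "y = h (cayley w u)" using D.k_h[OF wr] by auto
    have u1: "u \<in> ball 0 1" using u(1) r by auto
    have cr: "cayley w u \<in> rhp" by (rule cayley_rhp[OF wr u1])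
    have "pseudo_dist w (cayley w u) < r"
      unfolding pseudo_dist_def cayley_inverse[OF wr u1] using u(1) by simp
    then have "cayley w u \<in> wedge (4 / (1 - r\<^sup>2) * (M + 1)) a"
      by (intro pseudo_disc_wedge[OF less_imp_le[OF r(1)] r(2) M(1,2) _ cr]) (use w in \<open>simp_all add: r_def\<close>)
    then show "y \<in> D1" using sub u(2) by (auto simp: r_def)
  qed
  from hyp_density_comparison[OF D D1 D.h_D[OF wr] wD1 r(1) less_imp_le[OF r(2)] this]
  show ?thesis using M(3) by (simp add: r_def field_simps)
qed

theorem theorem5p10:
  fixes D1 D2 :: "complex set" and \<zeta> :: prime_end
    and \<gamma> :: "real \<Rightarrow> complex" and K :: real
  assumes "sc_domain D1" and "sc_domain D2" and "D1 \<subseteq> D2" and "D2 \<noteq> UNIV"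
    and "\<zeta> \<in> prime_ends D2" and "internally_tangent D1 D2 \<zeta>"
    and "hyp_geodesic_on D2 {0..} \<gamma>" and "lands_at D2 \<gamma> \<zeta>"
    and "K > 1"
  shows "\<forall>R>0. \<exists>t1\<ge>0.
    hyp_sector D2 \<gamma> t1 R \<subseteq> D1 \<and>
    (\<forall>z \<in> hyp_sector D2 \<gamma> t1 R.
       hyp_density D2 z \<le> hyp_density D1 z \<and> hyp_density D1 z \<le> K * hyp_density D2 z) \<and>
    (\<forall>z \<in> hyp_sector D2 \<gamma> t1 R. \<forall>w \<in> hyp_sector D2 \<gamma> t1 R.
       hyp_dist D2 z w \<le> hyp_dist D1 z w \<and> hyp_dist D1 z w \<le> K * hyp_dist D2 z w)"
proof (intro allI impI)
  fix R :: real assume R: "0 < R"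
  obtain \<gamma>0 where geo0: "hyp_geodesic_on D2 {0..} \<gamma>0" and land0: "lands_at D2 \<gamma>0 \<zeta>"
    and sectors: "\<And>R. 0 < R \<Longrightarrow> \<exists>t0\<ge>0. hyp_sector D2 \<gamma>0 t0 R \<subseteq> D1"
    using assms(6) unfolding internally_tangent_def by blast
  have \<gamma>D: "\<gamma> ` {0..} \<subseteq> D2" "\<gamma>0 ` {0..} \<subseteq> D2" using assms(7) geo0 by (auto simp: hyp_geodesic_on_def)
  obtain g \<sigma> where g: "riemann_map D2 g" and \<sigma>: "cmod \<sigma> = 1"
    and lim: "((\<lambda>t. the_inv_into (ball 0 1) g (\<gamma> t)) \<longlongrightarrow> \<sigma>) at_top"
      "((\<lambda>t. the_inv_into (ball 0 1) g (\<gamma>0 t)) \<longlongrightarrow> \<sigma>) at_top"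
    by (rule lands_at_common_riemann_map[OF assms(8) \<gamma>D(1) land0])
  define h k where "h = (\<lambda>w. g (\<sigma> * ((w - 1) / (w + 1))))"
    and "k = (\<lambda>z. cayley 1 (the_inv_into (ball 0 1) g z / \<sigma>))"
  have D2: "half_plane_chart D2 h k"
    unfolding h_def k_def by (rule half_plane_chart_of_riemann_map[OF g \<sigma>])
  have inf: "filterlim (\<lambda>t. k (\<gamma> t)) at_infinity at_top" "filterlim (\<lambda>t. k (\<gamma>0 t)) at_infinity at_top"
    unfolding k_def using landing_chart_at_infinity[OF g \<sigma>] \<gamma>D lim by auto
  have "D1 \<noteq> UNIV" using assms(3,4) by auto
  then obtain h1 k1 where D1: "half_plane_chart D1 h1 k1"
    using sc_domain_chart[OF assms(1)] by blast
  interpret D2: half_plane_chart D2 h k by (rule D2)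
  interpret D1: half_plane_chart D1 h1 k1 by (rule D1)
  obtain M where M: "0 < M" "\<And>a. 0 \<le> a \<Longrightarrow> \<exists>t1\<ge>0. hyp_sector D2 \<gamma> t1 R \<subseteq> h ` wedge M a"
    by (rule D2.sector_subset_wedge[OF assms(7) inf(1) R]) blast
  obtain M' \<delta> where M': "0 < M'" and \<delta>: "0 < \<delta>" "\<delta> \<le> 1"
    and retract: "\<And>a p. 0 < a \<Longrightarrow> hyp_rectifiable D2 p 0 1 \<Longrightarrow> p 0 \<in> h ` wedge M a \<Longrightarrow> p 1 \<in> h ` wedge M a \<Longrightarrow>
      \<exists>q S. q piecewise_C1_differentiable_on {0..1} \<and> q ` {0..1} \<subseteq> h ` wedge M' (a * \<delta>) \<and>
        q 0 = p 0 \<and> q 1 = p 1 \<and> finite S \<and> (\<forall>t\<in>{0..1} - S. hyp_speed D2 q t \<le> hyp_speed D2 p t)"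
    by (rule D2.retract_path_to_wedge[OF M(1)]) blast
  \<comment> \<open>\<open>N\<close> is a slope that serves both the sector and the curves retracted towards it, and
    \<open>C * (N + 1)\<close> is the slope that \<open>wedge_comparison\<close> needs inside \<open>D1\<close>. The cut-off \<open>b\<close> comes from
    the tangency; it is raised to \<open>C * b\<close> for \<open>wedge_comparison\<close> and to \<open>C * b / \<delta>\<close> for the
    retraction.\<close>
  define N where "N = max M M'"
  define C where "C = 4 / (1 - (1 / K)\<^sup>2)"
  have "0 < (1 / K)\<^sup>2" "(1 / K)\<^sup>2 < 1" using assms(9) by (auto simp: abs_square_less_1)
  then have C: "4 \<le> C" unfolding C_def by (simp add: field_simps)
  have N: "0 < N" "M \<le> N" "M' \<le> N" using M(1) by (auto simp: N_def)
  have "0 < C * (N + 1)" using C N by simp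
  then obtain b where b: "0 < b" "h ` wedge (C * (N + 1)) b \<subseteq> D1"
    using D2.wedge_subset_of_sectors[OF geo0 inf(2) sectors] by metis
  define a where "a = C * b / \<delta>"
  have a: "0 < a" "C * b \<le> a" "a * \<delta> = C * b"
    using C b(1) \<delta> by (auto simp: a_def field_simps)
  have "N \<le> C * N" "b \<le> C * b" using C N(1) b(1) by (auto simp: mult_le_cancel_right1)
  then have NC: "N \<le> C * (N + 1)" "b \<le> C * b" using C by (auto simp: algebra_simps)
  have big: "h ` wedge N (C * b) \<subseteq> D1"
    using wedge_mono[OF NC(1) less_imp_le[OF b(1)] NC(2)] b(2) by blast
  have dens: "hyp_density D1 z \<le> K * hyp_density D2 z" if "z \<in> h ` wedge N (C * b)" for z
    using wedge_comparison[OF D2 D1 N(1) less_imp_le[OF b(1)] assms(9)] b(2) big that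
    unfolding C_def by blast
  have Ma: "h ` wedge M a \<subseteq> h ` wedge N (C * b)"
    by (intro image_mono wedge_mono) (use N a b C in auto)
  have M'a: "h ` wedge M' (a * \<delta>) \<subseteq> h ` wedge N (C * b)"
    by (intro image_mono wedge_mono) (use N a b C in auto)
  obtain t1 where t1: "0 \<le> t1" "hyp_sector D2 \<gamma> t1 R \<subseteq> h ` wedge M a"
    using M(2)[of a] a by auto
  have dist: "hyp_dist D1 z w \<le> K * hyp_dist D2 z w" if zw: "z \<in> h ` wedge M a" "w \<in> h ` wedge M a" for z w
  proof -
    have zwD2: "z \<in> D2" "w \<in> D2" using zw Ma big assms(3) by auto
    obtain p0 where p0: "hyp_rectifiable D2 p0 0 1" "p0 0 = z" "p0 1 = w"
      by (rule D2.rectifiable_path_exists[OF zwD2])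
    have "hyp_dist D1 z w / K \<le> hyp_dist D2 z w"
      unfolding hyp_dist_def[of D2]
    proof (rule cInf_greatest)
      show "{hyp_length D2 p 0 1 |p. hyp_rectifiable D2 p 0 1 \<and> p 0 = z \<and> p 1 = w} \<noteq> {}"
        using p0 by blast
      fix l assume "l \<in> {hyp_length D2 p 0 1 |p. hyp_rectifiable D2 p 0 1 \<and> p 0 = z \<and> p 1 = w}"
      then obtain p where p: "l = hyp_length D2 p 0 1" "hyp_rectifiable D2 p 0 1" "p 0 = z" "p 1 = w"
        by blast
      obtain q S where q: "q piecewise_C1_differentiable_on {0..1}" "q ` {0..1} \<subseteq> h ` wedge M' (a * \<delta>)"
        "q 0 = z" "q 1 = w" "finite S" "\<And>t. t \<in> {0..1} - S \<Longrightarrow> hyp_speed D2 q t \<le> hyp_speed D2 p t"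
        using retract[OF a(1) p(2)] p(3,4) zw by metis
      have qD1: "q ` {0..1} \<subseteq> D1" using q(2) M'a big by blast
      have speed: "hyp_speed D1 q t \<le> K * hyp_speed D2 p t" if t: "t \<in> {0..1} - S" for t
      proof -
        have "q t \<in> h ` wedge N (C * b)" using q(2) M'a t by blast
        then have "hyp_speed D1 q t \<le> K * hyp_speed D2 q t"
          unfolding hyp_speed_def mult.assoc[symmetric] by (intro mult_right_mono dens) auto
        also have "\<dots> \<le> K * hyp_speed D2 p t" using q(6)[OF t] assms(9) by simp
        finally show ?thesis .
      qed
      have "hyp_speed D2 p integrable_on {0..1}" using p(2) by (simp add: hyp_rectifiable_def)
      then have int: "(\<lambda>t. K * hyp_speed D2 p t) integrable_on {0..1}"
        by (rule integrable_on_mult_right)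
      note maj = D1.hyp_rectifiable_majorant[OF qD1 q(1) int q(5) speed]
      have "hyp_dist D1 z w \<le> hyp_length D1 q 0 1" by (rule D1.hyp_dist_le_length[OF maj(1) q(3,4)])
      also have "\<dots> \<le> K * l" using maj(2) p(1) by (simp add: hyp_length_def)
      finally show "hyp_dist D1 z w / K \<le> l" using assms(9) by (simp add: field_simps)
    qed
    then show ?thesis using assms(9) by (simp add: field_simps)
  qed
  show "\<exists>t1\<ge>0. hyp_sector D2 \<gamma> t1 R \<subseteq> D1 \<and>
    (\<forall>z \<in> hyp_sector D2 \<gamma> t1 R.
       hyp_density D2 z \<le> hyp_density D1 z \<and> hyp_density D1 z \<le> K * hyp_density D2 z) \<and>
    (\<forall>z \<in> hyp_sector D2 \<gamma> t1 R. \<forall>w \<in> hyp_sector D2 \<gamma> t1 R.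
       hyp_dist D2 z w \<le> hyp_dist D1 z w \<and> hyp_dist D1 z w \<le> K * hyp_dist D2 z w)"
  proof (intro exI conjI ballI)
    show "0 \<le> t1" by (rule t1)
    show sub: "hyp_sector D2 \<gamma> t1 R \<subseteq> D1" using t1(2) Ma big by blast
    fix z assume z: "z \<in> hyp_sector D2 \<gamma> t1 R"
    show "hyp_density D2 z \<le> hyp_density D1 z"
      using hyp_density_antimono[OF D2 D1 assms(3)] sub z by blast
    show "hyp_density D1 z \<le> K * hyp_density D2 z" using dens t1(2) Ma z by blast
    fix w assume w: "w \<in> hyp_sector D2 \<gamma> t1 R"
    show "hyp_dist D2 z w \<le> hyp_dist D1 z w"
      using hyp_dist_antimono[OF D2 D1 assms(3)] sub z w by blast
    show "hyp_dist D1 z w \<le> K * hyp_dist D2 z w" using dist t1(2) z w by blast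
  qed
qed

end
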